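(* Let $(X,d)$ be a complete, separable metric space, $\mathfrak{m}$ a Borel measure on $X$, $K\in\mathbb{R}$ and $N<0$. For $A_0,A_1\subset X$ and $t\in[0,1]$, let $A_t$ be the set consisting of the points $\gamma(t)$ for minimal geodesics $\gamma:[0,1]\to X$ satisfying $\gamma(0)\in A_0$ and $\gamma(1)\in A_1$. (1) If $(X,d,\mathfrak{m})$ satisfies $\mathrm{CD}(K,N)$, then for any measurable sets $A_0,A_1\subset X$, with $\mathrm{diam}(A_0\cup A_1)<\pi\sqrt{(N-1)/K}$ if $K<0$, we have $$\mathfrak{m}[A_t]^{1/N}\le\sup_{x\in A_0,\,y\in A_1}\tau^{(1-t)}_{K,N}\big(d(x,y)\big)\,\mathfrak{m}[A_0]^{1/N}+\sup_{x\in A_0,\,y\in A_1}\tau^{(t)}_{K,N}\big(d(x,y)\big)\,\mathfrak{m}[A_1]^{1/N}$$ for any $t\in[0,1]$. (2) If $(X,d,\mathfrak{m})$ satisfies $\mathrm{CD}^*(K,N)$, then for any measurable sets $A_0,A_1\subset X$, with $\mathrm{diam}(A_0\cup A_1)<\pi\sqrt{N/K}$ if $K<0$, we have $$\mathfrak{m}[A_t]^{1/N}\le\sup_{x\in A_0,\,y\in A_1}\sigma^{(1-t)}_{K/N}\big(d(x,y)\big)\,\mathfrak{m}[A_0]^{1/N}+\sup_{x\in A_0,\,y\in A_1}\sigma^{(t)}_{K/N}\big(d(x,y)\big)\,\mathfrak{m}[A_1]^{1/N}$$ for any $t\in[0,1]$. Here $0^{1/N}=\infty$ and $\infty^{1/N}=0$,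 and the right-hand sides are read as $+\infty$ if $\mathfrak{m}[A_0]=0$ or $\mathfrak{m}[A_1]=0$.
   Context: A minimal geodesic in a metric space $(X,d)$ is a curve $\gamma:[0,1]\to X$ with $d(\gamma(s),\gamma(t))=|s-t|\,d(\gamma(0),\gamma(1))$ for all $s,t\in[0,1]$. For $\kappa\in\mathbb{R}$ and $\theta\ge 0$, let $\mathfrak{s}_\kappa(\theta)=\frac{1}{\sqrt{\kappa}}\sin(\sqrt{\kappa}\theta)$ if $\kappa>0$, $\mathfrak{s}_0(\theta)=\theta$, and $\mathfrak{s}_\kappa(\theta)=\frac{1}{\sqrt{-\kappa}}\sinh(\sqrt{-\kappa}\theta)$ if $\kappa<0$. For $t\in[0,1]$ let $\sigma^{(t)}_\kappa(\theta)=\mathfrak{s}_\kappa(t\theta)/\mathfrak{s}_\kappa(\theta)$ (with $\theta>0$ if $\kappa\le0$, $\theta\in(0,\pi/\sqrt{\kappa})$ if $\kappa>0$), and $\sigma^{(t)}_\kappa(0)=t$. For $N<0$ and $t\in(0,1]$ let $\tau^{(t)}_{K,N}(\theta)=t^{1/N}\sigma^{(t)}_{K/(N-1)}(\theta)^{(N-1)/N}$, and $\tau^{(0)}_{K,N}(\theta)=0$. When $K<0$, set $\sigma^{(t)}_{K/N}(\theta)=\infty$ if $\theta\ge\pi\sqrt{N/K}$ and $\tau^{(t)}_{K,N}(\theta)=\infty$ if $\theta\ge\pi\sqrt{(N-1)/K}$. $\mathcal{P}^2(X)$ is the set of Borel probability measures on $X$ with finite second moment, with the $L^2$-Wasserstein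 distance $W_2(\mu,\nu)=\inf_{\pi}(\int_{X\times X}d(x,y)^2\,\pi(dxdy))^{1/2}$, the infimum being over all couplings $\pi$ of $\mu$ and $\nu$; a coupling attaining it is optimal. For $N<0$ the Rényi entropy is $S_N(\mu)=\int_X\rho^{(N-1)/N}\,d\mathfrak{m}$ if $\mu=\rho\mathfrak{m}$ is absolutely continuous with respect to $\mathfrak{m}$, and $S_N(\mu)=\infty$ otherwise. $(X,d,\mathfrak{m})$ satisfies $\mathrm{CD}(K,N)$ ($N<0$) if any pair of absolutely continuous measures $\mu_0=\rho_0\mathfrak{m},\mu_1=\rho_1\mathfrak{m}\in\mathcal{P}^2(X)$ admits a minimal geodesic $(\mu_t)_{t\in[0,1]}\subset\mathcal{P}^2(X)$ with respect to $W_2$ and an optimal coupling $\pi$ of $\mu_0,\mu_1$ such that $S_{N'}(\mu_t)\le\int_{X\times X}\{\tau^{(1-t)}_{K,N'}(d(x,y))\rho_0(x)^{-1/N'}+\tau^{(t)}_{K,N'}(d(x,y))\rho_1(y)^{-1/N'}\}\,\pi(dxdy)$ for all $t\in[0,1]$ and $N'\in[N,0)$. It satisfies $\mathrm{CD}^*(K,N)$ if the same holds with $\tau^{(1-t)}_{K,N'},\tau^{(t)}_{K,N'}$ replaced by $\sigma^{(1-t)}_{K/N'},\sigma^{(t)}_{K/N'}$.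
   Formalization: The Borel measure m is additionally assumed σ-finite; without this the claim fails, e.g. on two points of infinite mass each, where CD(0,N) holds vacuously but for A_0, A_1 the two points and t=1/2 the left side is ∞ and the right side 0. *)

theory Defs
  imports "HOL-Probability.Probability"
begin

text \<open>Real powers on \<open>[0, \<infinity>]\<close>; for negative exponents \<open>0\<close> and \<open>\<infinity>\<close> are exchanged, as required by
  \<open>0\<^sup>1\<^sup>/\<^sup>N = \<infinity>\<close> and \<open>\<infinity>\<^sup>1\<^sup>/\<^sup>N = 0\<close> for \<open>N < 0\<close>.\<close>

definition enn_powr :: "ennreal \<Rightarrow> real \<Rightarrow> ennreal" where
  "enn_powr x a =
     (if a = 0 then 1
      else if x = 0 then (if a < 0 then \<infinity> else 0)
      else if x = \<infinity> then (if a < 0 then 0 else \<infinity>)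
      else ennreal (enn2real x powr a))"

definition gen_sin :: "real \<Rightarrow> real \<Rightarrow> real" where
  "gen_sin \<kappa> \<theta> =
     (if \<kappa> > 0 then sin (sqrt \<kappa> * \<theta>) / sqrt \<kappa>
      else if \<kappa> = 0 then \<theta>
      else sinh (sqrt (- \<kappa>) * \<theta>) / sqrt (- \<kappa>))"

text \<open>For \<open>\<kappa> = K / N\<close> with \<open>K, N < 0\<close> the threshold \<open>pi / sqrt \<kappa>\<close> is \<open>pi * sqrt (N / K)\<close>.
  Below it the quotient is nonnegative, so the embedding into \<^typ>\<open>ennreal\<close> does not truncate.\<close>

definition sigma_coeff :: "real \<Rightarrow> real \<Rightarrow> real \<Rightarrow> ennreal" where
  "sigma_coeff \<kappa> t \<theta> =
     (if \<kappa> > 0 \<and> pi / sqrt \<kappa> \<le> \<theta> then \<infinity>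
      else if \<theta> = 0 then ennreal t
      else ennreal (gen_sin \<kappa> (t * \<theta>) / gen_sin \<kappa> \<theta>))"

text \<open>The value \<open>\<infinity>\<close> beyond the threshold takes precedence over the value \<open>0\<close> at \<open>t = 0\<close>. In the
  curvature-dimension condition the choice is immaterial: the coefficient for \<open>1 - t\<close> is infinite
  at the same pairs of points.\<close>

definition tau_coeff :: "real \<Rightarrow> real \<Rightarrow> real \<Rightarrow> real \<Rightarrow> ennreal" where
  "tau_coeff K N t \<theta> =
     (if K < 0 \<and> pi * sqrt ((N - 1) / K) \<le> \<theta> then \<infinity>
      else if t = 0 then 0
      else ennreal (t powr (1 / N)) * enn_powr (sigma_coeff (K / (N - 1)) t \<theta>) ((N - 1) / N))"

definition minimal_geodesic :: "('b \<Rightarrow> 'b \<Rightarrow> real) \<Rightarrow> (real \<Rightarrow> 'b) \<Rightarrow> bool" where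
  "minimal_geodesic d \<gamma> \<longleftrightarrow>
     (\<forall>s\<in>{0..1}. \<forall>t\<in>{0..1}. d (\<gamma> s) (\<gamma> t) = \<bar>s - t\<bar> * d (\<gamma> 0) (\<gamma> 1))"

text \<open>For Borel sets \<open>A\<^sub>0\<close> and \<open>A\<^sub>1\<close> the following set is analytic but need not be Borel, and
  \<^const>\<open>emeasure\<close> vanishes outside the \<open>\<sigma>\<close>-algebra. Its size is therefore to be taken with
  \<^const>\<open>outer_measure_of\<close>, which on analytic sets agrees with the completed measure.\<close>

definition intermediate_set ::
    "'a::metric_space set \<Rightarrow> 'a set \<Rightarrow> real \<Rightarrow> 'a set" where
  "intermediate_set A\<^sub>0 A\<^sub>1 t =
     {\<gamma> t |\<gamma>. minimal_geodesic dist \<gamma> \<and> \<gamma> 0 \<in> A\<^sub>0 \<and> \<gamma> 1 \<in> A\<^sub>1}"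

definition P2 :: "'a::polish_space measure set" where
  "P2 = {\<mu>. sets \<mu> = sets borel \<and> prob_space \<mu> \<and>
          (\<exists>x\<^sub>0. (\<integral>\<^sup>+x. ennreal ((dist x\<^sub>0 x)\<^sup>2) \<partial>\<mu>) < \<infinity>)}"

definition couplings ::
    "'a::polish_space measure \<Rightarrow> 'a measure \<Rightarrow> ('a \<times> 'a) measure set" where
  "couplings \<mu> \<nu> =
     {\<pi>. sets \<pi> = sets borel \<and> distr \<pi> borel fst = \<mu> \<and> distr \<pi> borel snd = \<nu>}"

definition transport_cost :: "('a::polish_space \<times> 'a) measure \<Rightarrow> ennreal" where
  "transport_cost \<pi> = enn_powr (\<integral>\<^sup>+(x, y). ennreal ((dist x y)\<^sup>2) \<partial>\<pi>) (1 / 2)"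

definition W2 :: "'a::polish_space measure \<Rightarrow> 'a measure \<Rightarrow> ennreal" where
  "W2 \<mu> \<nu> = (INF \<pi>\<in>couplings \<mu> \<nu>. transport_cost \<pi>)"

definition optimal_coupling ::
    "('a::polish_space \<times> 'a) measure \<Rightarrow> 'a measure \<Rightarrow> 'a measure \<Rightarrow> bool" where
  "optimal_coupling \<pi> \<mu> \<nu> \<longleftrightarrow> \<pi> \<in> couplings \<mu> \<nu> \<and> transport_cost \<pi> = W2 \<mu> \<nu>"

text \<open>\<^const>\<open>W2\<close> is finite on \<^const>\<open>P2\<close>, so passing to reals loses nothing here.\<close>

definition W2_geodesic :: "(real \<Rightarrow> 'a::polish_space measure) \<Rightarrow> bool" where
  "W2_geodesic \<mu> \<longleftrightarrow>
     (\<forall>t\<in>{0..1}. \<mu> t \<in> P2) \<and> minimal_geodesic (\<lambda>\<mu> \<nu>. enn2real (W2 \<mu> \<nu>)) \<mu>"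

text \<open>The reference measure is always \<open>\<sigma>\<close>-finite below, so that by the Radon-Nikodym theorem absolute
  continuity amounts to having a density, which is unique almost everywhere.\<close>

definition renyi_entropy :: "real \<Rightarrow> 'a measure \<Rightarrow> 'a measure \<Rightarrow> ennreal" where
  "renyi_entropy N m \<mu> =
     (if absolutely_continuous m \<mu> then \<integral>\<^sup>+x. enn_powr (RN_deriv m \<mu> x) ((N - 1) / N) \<partial>m
      else \<infinity>)"

text \<open>The common form of the two conditions: \<open>\<beta> N' t \<theta>\<close> is the distortion coefficient.\<close>

definition CD_with ::
    "(real \<Rightarrow> real \<Rightarrow> real \<Rightarrow> ennreal) \<Rightarrow> real \<Rightarrow> 'a::polish_space measure \<Rightarrow> bool" where
  "CD_with \<beta> N m \<longleftrightarrow>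
     (\<forall>\<rho>\<^sub>0\<in>borel_measurable m. \<forall>\<rho>\<^sub>1\<in>borel_measurable m.
        density m \<rho>\<^sub>0 \<in> P2 \<longrightarrow> density m \<rho>\<^sub>1 \<in> P2 \<longrightarrow>
        (\<exists>\<mu> \<pi>. W2_geodesic \<mu> \<and> \<mu> 0 = density m \<rho>\<^sub>0 \<and> \<mu> 1 = density m \<rho>\<^sub>1 \<and>
           optimal_coupling \<pi> (density m \<rho>\<^sub>0) (density m \<rho>\<^sub>1) \<and>
           (\<forall>t\<in>{0..1}. \<forall>N'\<in>{N..<0}.
              renyi_entropy N' m (\<mu> t) \<le>
                (\<integral>\<^sup>+(x, y). \<beta> N' (1 - t) (dist x y) * enn_powr (\<rho>\<^sub>0 x) (- 1 / N')
                          + \<beta> N' t (dist x y) * enn_powr (\<rho>\<^sub>1 y) (- 1 / N') \<partial>\<pi>))))"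

definition CD :: "real \<Rightarrow> real \<Rightarrow> 'a::polish_space measure \<Rightarrow> bool" where
  "CD K N m \<longleftrightarrow> CD_with (\<lambda>N' t \<theta>. tau_coeff K N' t \<theta>) N m"

definition CD_star :: "real \<Rightarrow> real \<Rightarrow> 'a::polish_space measure \<Rightarrow> bool" where
  "CD_star K N m \<longleftrightarrow> CD_with (\<lambda>N' t \<theta>. sigma_coeff (K / N') t \<theta>) N m"

end

theory Submission
  imports Defs
begin

text \<open>
  Take \<open>A\<^sub>0\<close> and \<open>A\<^sub>1\<close> bounded and of finite positive measure, and apply the curvature-dimension
  condition to the uniform distributions on them. The densities are constant, so the right-hand side
  of the entropy inequality is at most the right-hand side of the claim. On the left, if the measure
  \<open>\<mu>\<^sub>t\<close> of the Wasserstein geodesic gives full mass to a set \<open>E\<close>, then convexity of \<open>r \<mapsto> r\<^sup>p\<close> with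
  \<open>p = (N - 1) / N > 1\<close> makes its entropy at least \<open>m(E)\<close> to the power \<open>1 / N\<close>. It remains to see that \<open>\<mu>\<^sub>t\<close> is
  concentrated on every Borel set \<open>E\<close> containing the \<open>t\<close>-intermediate points of \<open>A\<^sub>0\<close> and \<open>A\<^sub>1\<close>
  (\<open>W2_geodesic_concentrated_on_intermediate_set\<close>). Arbitrary \<open>A\<^sub>0\<close> and \<open>A\<^sub>1\<close> are then exhausted by
  bounded sets of finite measure; the passage to the limit uses that the suprema of the distortion
  coefficients are finite, as otherwise the product of a supremum with a vanishing power would be \<open>0\<close>
  on the right while the approximating products are infinite.

  The concentration is usually deduced from a representation of Wasserstein geodesics by probability
  measures on the space of geodesics. Here it is obtained without disintegration, existence of optimal
  couplings, or compactness of sets of measures, by producing a single geodesic. If \<open>\<mu>\<^sub>t\<close> charges the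
  complement of \<open>E\<close>, it charges a compact subset \<open>C\<close> of that complement. Choose compact
  sets \<open>K\<^sub>s\<close> for \<open>s\<close> in a countable dense set of times, with \<open>K\<^sub>0 \<subseteq> A\<^sub>0\<close>, \<open>K\<^sub>1 \<subseteq> A\<^sub>1\<close> and \<open>K\<^sub>t \<subseteq> C\<close>, such that
  the masses \<open>\<mu>\<^sub>s\<close> of their complements add up to less than \<open>1\<close>. A geodesic with \<open>\<gamma>(s) \<in> K\<^sub>s\<close> at all these
  times contradicts \<open>C \<inter> E = {}\<close>; by Tychonoff's theorem and completeness it suffices to find, for
  finitely many times, points of the \<open>K\<^sub>s\<close> that satisfy the geodesic relation up to an error.

  For such a finite grid \<open>0 = s\<^sub>0 < \<dots> < s\<^sub>n = 1\<close> with increments \<open>\<Delta>\<^sub>i\<close> (\<open>exists_near_geodesic_chain\<close>) near-optimal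
  couplings of consecutive measures are discretised along a fine countable partition and glued to a
  Markov chain \<open>X\<^sub>0, \<dots>, X\<^sub>n\<close> (\<open>markov_chain_of_couplings\<close>). Its energy
  \<open>\<Sum>\<^sub>i d(X\<^sub>i, X\<^sub>i\<^sub>+\<^sub>1)\<^sup>2 / \<Delta>\<^sub>i\<close> always dominates \<open>d(X\<^sub>0, X\<^sub>n)\<^sup>2\<close> by the Cauchy-Schwarz inequality, has expectation close
  to \<open>W\<^sub>2(\<mu>\<^sub>0, \<mu>\<^sub>1)\<^sup>2\<close>, while the expectation of \<open>d(X\<^sub>0, X\<^sub>n)\<^sup>2\<close> is hardly smaller, because the law of
  \<open>(X\<^sub>0, X\<^sub>n)\<close> lifts to a coupling of \<open>\<mu>\<^sub>0\<close> and \<open>\<mu>\<^sub>1\<close> (\<open>coupling_with_discretised_law\<close>). So the two quantities almost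
  agree outside an event of small probability, in particular at some point of the event that all \<open>X\<^sub>i\<close>
  come from \<open>K\<close>, and almost equality in Cauchy-Schwarz says that the chain is almost geodesic.
\<close>

section \<open>Gluing discretised couplings\<close>

text \<open>
  For laws on a discrete space consecutive couplings glue by conditioning: the new coordinate is
  drawn from the next coupling conditioned on the present state.
\<close>

lemma markov_chain_of_couplings:
  fixes p :: "nat \<Rightarrow> ('b \<times> 'b) pmf" and \<nu> :: "nat \<Rightarrow> 'b pmf"
  assumes "\<And>i. i < n \<Longrightarrow> map_pmf fst (p i) = \<nu> i"
    and "\<And>i. i < n \<Longrightarrow> map_pmf snd (p i) = \<nu> (Suc i)"
  shows "\<exists>Q :: (nat \<Rightarrow> 'b) pmf. (\<forall>i<n. map_pmf (\<lambda>f. (f i, f (Suc i))) Q = p i)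
            \<and> (\<forall>i\<le>n. map_pmf (\<lambda>f. f i) Q = \<nu> i)"
  using assms
proof (induction n)
  case 0
  show ?case
    by (rule exI[of _ "map_pmf (\<lambda>b i. b) (\<nu> 0)"]) (simp add: map_pmf_comp)
next
  case (Suc n)
  have "\<exists>Q :: (nat \<Rightarrow> 'b) pmf. (\<forall>i<n. map_pmf (\<lambda>f. (f i, f (Suc i))) Q = p i)
            \<and> (\<forall>i\<le>n. map_pmf (\<lambda>f. f i) Q = \<nu> i)"
    by (rule Suc.IH) (use Suc.prems in auto)
  then obtain Q :: "(nat \<Rightarrow> 'b) pmf"
    where Q: "\<And>i. i < n \<Longrightarrow> map_pmf (\<lambda>f. (f i, f (Suc i))) Q = p i"
      and Q_marg: "\<And>i. i \<le> n \<Longrightarrow> map_pmf (\<lambda>f. f i) Q = \<nu> i"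
    by blast
  define k where "k a = cond_pmf (p n) {ab. a = fst ab}" for a
  define Q' where "Q' = bind_pmf Q (\<lambda>f. map_pmf (\<lambda>ab. f(Suc n := snd ab)) (k (f n)))"
  have fst_p: "map_pmf fst (p n) = \<nu> n" and snd_p: "map_pmf snd (p n) = \<nu> (Suc n)"
    using Suc.prems by auto
  have ne: "set_pmf (p n) \<inter> {ab. a = fst ab} \<noteq> {}" if "a \<in> set_pmf (\<nu> n)" for a
    using that by (auto simp flip: fst_p)
  \<comment> \<open>The conditional laws recombine to the next coupling.\<close>
  have step: "bind_pmf (\<nu> n) k = p n"
    unfolding k_def
  proof (rule bind_cond_pmf_cancel[OF ne])
    fix ab assume "ab \<in> set_pmf (p n)"
    then show "set_pmf (\<nu> n) \<inter> {a. a = fst ab} \<noteq> {}"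
      by (auto simp flip: fst_p)
  next
    fix a ab assume "a = fst (ab :: 'b \<times> 'b)"
    then show "measure_pmf.prob (p n) {ab. a = fst ab} = measure_pmf.prob (\<nu> n) {a. a = fst ab}"
      unfolding fst_p[symmetric] by (auto intro!: arg_cong[where f="measure _"])
  qed
  have old: "map_pmf g Q' = map_pmf g Q" if "\<And>f b. g (f(Suc n := b)) = g f" for g :: "_ \<Rightarrow> 'c"
    unfolding Q'_def map_bind_pmf map_pmf_comp that by (simp add: map_pmf_const map_pmf_def)
  have new: "map_pmf (\<lambda>f. (f n, f (Suc n))) Q' = p n"
  proof -
    have "map_pmf (\<lambda>ab. (f n, snd ab)) (k (f n)) = k (f n)" if "f \<in> set_pmf Q" for f
    proof -
      have "f n \<in> set_pmf (\<nu> n)"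
        using that by (auto simp flip: Q_marg)
      then have "map_pmf (\<lambda>ab. (f n, snd ab)) (k (f n)) = map_pmf (\<lambda>ab. ab) (k (f n))"
        by (intro map_pmf_cong) (auto simp: k_def set_cond_pmf[OF ne])
      then show ?thesis by simp
    qed
    then have "map_pmf (\<lambda>f. (f n, f (Suc n))) Q' = bind_pmf Q (\<lambda>f. k (f n))"
      unfolding Q'_def map_bind_pmf map_pmf_comp by (auto intro!: bind_pmf_cong)
    also have "\<dots> = bind_pmf (map_pmf (\<lambda>f. f n) Q) k"
      by (simp add: bind_map_pmf)
    finally show ?thesis by (simp add: Q_marg step)
  qed
  have "map_pmf (\<lambda>f. f (Suc n)) Q' = map_pmf snd (map_pmf (\<lambda>f. (f n, f (Suc n))) Q')"
    by (simp add: map_pmf_comp)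
  then have "map_pmf (\<lambda>f. f (Suc n)) Q' = \<nu> (Suc n)"
    by (simp add: new snd_p)
  moreover have "map_pmf (\<lambda>f. f i) Q' = \<nu> i" if "i \<le> n" for i
    using old[of "\<lambda>f. f i"] that by (simp add: Q_marg)
  moreover have "map_pmf (\<lambda>f. (f i, f (Suc i))) Q' = p i" if "i < n" for i
    using old[of "\<lambda>f. (f i, f (Suc i))"] that by (simp add: Q)
  ultimately show ?case
    using new by (intro exI[of _ Q']) (auto simp: less_Suc_eq le_Suc_eq)
qed

lemma pmf_of_law:
  fixes q :: "'a \<Rightarrow> 'k::countable"
  assumes "prob_space M" and q: "q \<in> measurable M (count_space UNIV)"
  obtains p where "measure_pmf p = distr M (count_space UNIV) q"
proof -
  interpret D: prob_space "distr M (count_space UNIV) q"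
    using assms by (rule prob_space.prob_space_distr)
  have "AE x in distr M (count_space UNIV) q. measure (distr M (count_space UNIV) q) {x} \<noteq> 0"
    by (subst D.AE_support_countable) (auto intro!: exI[of _ UNIV])
  then have "measure_pmf (Abs_pmf (distr M (count_space UNIV) q)) = distr M (count_space UNIV) q"
    by (intro Abs_pmf_inverse) (auto simp: D.prob_space_axioms)
  then show ?thesis ..
qed

text \<open>
  The cells of \<open>q\<close> are a countable Borel partition into sets of radius less than \<open>\<epsilon>\<close>, with \<open>r\<close> choosing
  their centres.
\<close>

lemma countable_discretisation:
  assumes "\<epsilon> > 0"
  obtains q :: "'a::polish_space \<Rightarrow> nat" and r :: "nat \<Rightarrow> 'a"
  where "q \<in> measurable borel (count_space UNIV)" "\<And>x. dist x (r (q x)) < \<epsilon>"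
proof -
  obtain D :: "'a set" where D: "countable D" and dense: "\<And>X. open X \<Longrightarrow> X \<noteq> {} \<Longrightarrow> \<exists>d\<in>D. d \<in> X"
    using countable_dense_exists by blast
  have "D \<noteq> {}" using dense[of UNIV] by auto
  define r where "r = from_nat_into D"
  define q where "q x = (LEAST n. dist x (r n) < \<epsilon>)" for x
  have "\<exists>n. dist x (r n) < \<epsilon>" for x
  proof -
    obtain d where "d \<in> D" "d \<in> ball x \<epsilon>"
      using dense[of "ball x \<epsilon>"] assms by auto
    then show ?thesis
      using from_nat_into_surj[OF D] by (auto simp: r_def)
  qed
  then have "dist x (r (q x)) < \<epsilon>" for x
    unfolding q_def by (metis (mono_tags, lifting) LeastI_ex)
  moreover have "q \<in> measurable borel (count_space UNIV)"
    unfolding q_def by measurable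
  ultimately show ?thesis by (rule that[rotated])
qed

lemma pmf_row_sum:
  fixes l :: "('i \<times> 'j) pmf"
  shows "(\<integral>\<^sup>+j. ennreal (pmf l (i, j)) \<partial>count_space UNIV) = pmf (map_pmf fst l) i"
proof -
  have "bij_betw (\<lambda>j. (i, j)) UNIV (fst -` {i} :: ('i \<times> 'j) set)"
    by (auto simp: bij_betw_def inj_on_def)
  from nn_integral_bij_count_space[OF this, of "\<lambda>x. ennreal (pmf l x)"]
  show ?thesis
    by (simp add: nn_integral_pmf pmf_map measure_pmf.emeasure_eq_measure)
qed

lemma pmf_column_sum:
  fixes l :: "('i \<times> 'j) pmf"
  shows "(\<integral>\<^sup>+i. ennreal (pmf l (i, j)) \<partial>count_space UNIV) = pmf (map_pmf snd l) j"
proof -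
  have "bij_betw (\<lambda>i. (i, j)) UNIV (snd -` {j} :: ('i \<times> 'j) set)"
    by (auto simp: bij_betw_def inj_on_def)
  from nn_integral_bij_count_space[OF this, of "\<lambda>x. ennreal (pmf l x)"]
  show ?thesis
    by (simp add: nn_integral_pmf pmf_map measure_pmf.emeasure_eq_measure)
qed

text \<open>
  A joint law of cells lifts to the points: given the cells \<open>i\<close> and \<open>j\<close>, draw the two points
  independently from \<open>\<mu>\<close> conditioned on cell \<open>i\<close> and from \<open>\<nu>\<close> conditioned on cell \<open>j\<close>. This mixture has an
  explicit density with respect to the product measure, so its marginals follow from Fubini's theorem.
\<close>

lemma coupling_with_discretised_law:
  fixes q :: "'a::polish_space \<Rightarrow> nat"
  assumes "prob_space \<mu>" "prob_space \<nu>" and sets: "sets \<mu> = sets borel" "sets \<nu> = sets borel"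
    and q[measurable]: "q \<in> measurable borel (count_space UNIV)"
    and fst_law: "measure_pmf (map_pmf fst l) = distr \<mu> (count_space UNIV) q"
    and snd_law: "measure_pmf (map_pmf snd l) = distr \<nu> (count_space UNIV) q"
  obtains \<pi> where "\<pi> \<in> couplings \<mu> \<nu>"
    "\<And>F :: nat \<times> nat \<Rightarrow> ennreal. (\<integral>\<^sup>+z. F (q (fst z), q (snd z)) \<partial>\<pi>) = (\<integral>\<^sup>+kl. F kl \<partial>l)"
proof -
  interpret \<mu>: prob_space \<mu> by fact
  interpret \<nu>: prob_space \<nu> by fact
  interpret P: pair_prob_space \<mu> \<nu> ..
  note [measurable_cong] = sets
  define a b where "a = map_pmf fst l" and "b = map_pmf snd l"
  \<comment> \<open>Division by zero gives weight \<open>0\<close>, which is harmless: cells of zero mass carry no mass of \<open>l\<close>.\<close>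
  define w where "w = (\<lambda>(i, j). ennreal (pmf l (i, j) / (pmf a i * pmf b j)))"
  define \<pi> where "\<pi> = density (\<mu> \<Otimes>\<^sub>M \<nu>) (\<lambda>z. w (q (fst z), q (snd z)))"
  have sets_pair: "sets (\<mu> \<Otimes>\<^sub>M \<nu>) = sets (borel :: ('a \<times> 'a) measure)"
    using sets by (simp add: borel_prod[symmetric] cong: sets_pair_measure_cong)
  have F_meas[measurable]: "(\<lambda>z. F (q (fst z), q (snd z))) \<in> borel_measurable (\<mu> \<Otimes>\<^sub>M \<nu>)"
    for F :: "nat \<times> nat \<Rightarrow> ennreal"
    by measurable
  have l_le: "pmf l (i, j) \<le> pmf a i" "pmf l (i, j) \<le> pmf b j" for i j
    unfolding a_def b_def pmf_map
    by (auto simp: measure_pmf_single[symmetric] intro!: measure_pmf.finite_measure_mono)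
  have l_zero: "pmf l (i, j) = 0" if "pmf a i = 0 \<or> pmf b j = 0" for i j
    using l_le[of i j] that pmf_nonneg[of l "(i, j)"] by auto
  have law_a: "(\<integral>\<^sup>+x. g (q x) \<partial>\<mu>) = (\<integral>\<^sup>+i. g i \<partial>a)" for g :: "nat \<Rightarrow> ennreal"
    unfolding a_def fst_law by (subst nn_integral_distr) auto
  have law_b: "(\<integral>\<^sup>+x. g (q x) \<partial>\<nu>) = (\<integral>\<^sup>+i. g i \<partial>b)" for g :: "nat \<Rightarrow> ennreal"
    unfolding b_def snd_law by (subst nn_integral_distr) auto
  have row: "(\<integral>\<^sup>+j. w (i, j) \<partial>b) = 1" if "pmf a i \<noteq> 0" for i
  proof -
    have "(\<integral>\<^sup>+j. w (i, j) \<partial>b) = (\<integral>\<^sup>+j. ennreal (1 / pmf a i) * ennreal (pmf l (i, j)) \<partial>count_space UNIV)"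
      unfolding nn_integral_measure_pmf
      using l_zero by (intro nn_integral_cong) (auto simp: w_def simp flip: ennreal_mult')
    also have "\<dots> = ennreal (1 / pmf a i) * ennreal (pmf a i)"
      by (subst nn_integral_cmult) (auto simp: pmf_row_sum a_def)
    finally show ?thesis
      using that by (simp flip: ennreal_mult')
  qed
  have column: "(\<integral>\<^sup>+i. w (i, j) \<partial>a) = 1" if "pmf b j \<noteq> 0" for j
  proof -
    have "(\<integral>\<^sup>+i. w (i, j) \<partial>a) = (\<integral>\<^sup>+i. ennreal (1 / pmf b j) * ennreal (pmf l (i, j)) \<partial>count_space UNIV)"
      unfolding nn_integral_measure_pmf
      using l_zero by (intro nn_integral_cong) (auto simp: w_def simp flip: ennreal_mult')
    also have "\<dots> = ennreal (1 / pmf b j) * ennreal (pmf b j)"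
      by (subst nn_integral_cmult) (auto simp: pmf_column_sum b_def)
    finally show ?thesis
      using that by (simp flip: ennreal_mult')
  qed
  have AE_a: "AE x in \<mu>. pmf a (q x) \<noteq> 0"
  proof -
    have "AE i in measure_pmf a. pmf a i \<noteq> 0"
      by (simp add: AE_measure_pmf_iff set_pmf_iff)
    then show ?thesis
      unfolding a_def fst_law by (subst (asm) AE_distr_iff) auto
  qed
  have AE_b: "AE x in \<nu>. pmf b (q x) \<noteq> 0"
  proof -
    have "AE i in measure_pmf b. pmf b i \<noteq> 0"
      by (simp add: AE_measure_pmf_iff set_pmf_iff)
    then show ?thesis
      unfolding b_def snd_law by (subst (asm) AE_distr_iff) auto
  qed
  have "distr \<pi> borel fst = \<mu>"
  proof (rule measure_eqI)
    fix A assume "A \<in> sets (distr \<pi> borel fst)"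
    then have A[measurable]: "A \<in> sets borel" by simp
    have "emeasure (distr \<pi> borel fst) A = (\<integral>\<^sup>+x. indicator A x \<partial>distr \<pi> borel fst)"
      by simp
    also have "\<dots> = (\<integral>\<^sup>+z. indicator A (fst z) \<partial>\<pi>)"
      by (rule nn_integral_distr) (auto simp: \<pi>_def)
    also have "\<dots> = (\<integral>\<^sup>+z. w (q (fst z), q (snd z)) * indicator A (fst z) \<partial>(\<mu> \<Otimes>\<^sub>M \<nu>))"
      unfolding \<pi>_def by (intro nn_integral_density) auto
    also have "\<dots> = (\<integral>\<^sup>+x. \<integral>\<^sup>+y. w (q x, q y) * indicator A x \<partial>\<nu> \<partial>\<mu>)"
      by (subst \<nu>.nn_integral_fst[symmetric]) auto
    also have "\<dots> = (\<integral>\<^sup>+x. (\<integral>\<^sup>+j. w (q x, j) \<partial>b) * indicator A x \<partial>\<mu>)"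
      by (simp add: nn_integral_multc flip: law_b)
    also have "\<dots> = (\<integral>\<^sup>+x. indicator A x \<partial>\<mu>)"
      using AE_a by (intro nn_integral_cong_AE) (auto simp: row)
    finally show "emeasure (distr \<pi> borel fst) A = emeasure \<mu> A"
      using A sets by simp
  qed (use sets in auto)
  moreover have "distr \<pi> borel snd = \<nu>"
  proof (rule measure_eqI)
    fix A assume "A \<in> sets (distr \<pi> borel snd)"
    then have A[measurable]: "A \<in> sets borel" by simp
    have "emeasure (distr \<pi> borel snd) A = (\<integral>\<^sup>+x. indicator A x \<partial>distr \<pi> borel snd)"
      by simp
    also have "\<dots> = (\<integral>\<^sup>+z. indicator A (snd z) \<partial>\<pi>)"
      by (rule nn_integral_distr) (auto simp: \<pi>_def)
    also have "\<dots> = (\<integral>\<^sup>+z. w (q (fst z), q (snd z)) * indicator A (snd z) \<partial>(\<mu> \<Otimes>\<^sub>M \<nu>))"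
      unfolding \<pi>_def by (intro nn_integral_density) auto
    also have "\<dots> = (\<integral>\<^sup>+y. \<integral>\<^sup>+x. w (q x, q y) * indicator A y \<partial>\<mu> \<partial>\<nu>)"
      by (subst P.nn_integral_snd[symmetric]) auto
    also have "\<dots> = (\<integral>\<^sup>+y. (\<integral>\<^sup>+i. w (i, q y) \<partial>a) * indicator A y \<partial>\<nu>)"
      by (simp add: nn_integral_multc flip: law_a)
    also have "\<dots> = (\<integral>\<^sup>+y. indicator A y \<partial>\<nu>)"
      using AE_b by (intro nn_integral_cong_AE) (auto simp: column)
    finally show "emeasure (distr \<pi> borel snd) A = emeasure \<nu> A"
      using A sets by simp
  qed (use sets in auto)
  ultimately have "\<pi> \<in> couplings \<mu> \<nu>"
    using sets_pair by (auto simp: couplings_def \<pi>_def)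
  moreover have "(\<integral>\<^sup>+z. F (q (fst z), q (snd z)) \<partial>\<pi>) = (\<integral>\<^sup>+kl. F kl \<partial>l)"
    for F :: "nat \<times> nat \<Rightarrow> ennreal"
  proof -
    have "(\<integral>\<^sup>+z. F (q (fst z), q (snd z)) \<partial>\<pi>)
        = (\<integral>\<^sup>+z. w (q (fst z), q (snd z)) * F (q (fst z), q (snd z)) \<partial>(\<mu> \<Otimes>\<^sub>M \<nu>))"
      unfolding \<pi>_def by (intro nn_integral_density) auto
    also have "\<dots> = (\<integral>\<^sup>+x. \<integral>\<^sup>+y. w (q x, q y) * F (q x, q y) \<partial>\<nu> \<partial>\<mu>)"
      by (subst \<nu>.nn_integral_fst[symmetric]) auto
    also have "\<dots> = (\<integral>\<^sup>+i. \<integral>\<^sup>+j. w (i, j) * F (i, j) \<partial>b \<partial>a)"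
      using law_a[of "\<lambda>i. \<integral>\<^sup>+j. w (i, j) * F (i, j) \<partial>b"] by (simp only: law_b[of "\<lambda>j. w (_, j) * F (_, j)"])
    also have "\<dots> = (\<integral>\<^sup>+i. \<integral>\<^sup>+j. pmf a i * (pmf b j * (w (i, j) * F (i, j)))
                      \<partial>count_space UNIV \<partial>count_space UNIV)"
      unfolding nn_integral_measure_pmf by (simp add: nn_integral_cmult)
    also have "\<dots> = (\<integral>\<^sup>+i. \<integral>\<^sup>+j. pmf l (i, j) * F (i, j) \<partial>count_space UNIV \<partial>count_space UNIV)"
    proof (intro nn_integral_cong)
      fix i j
      have "pmf a i * (pmf b j * (pmf l (i, j) / (pmf a i * pmf b j))) = pmf l (i, j)"
        using l_zero[of i j] by auto
      then have "ennreal (pmf a i) * (ennreal (pmf b j) * w (i, j)) = pmf l (i, j)"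
        by (simp add: w_def flip: ennreal_mult')
      then show "ennreal (pmf a i) * (ennreal (pmf b j) * (w (i, j) * F (i, j))) = pmf l (i, j) * F (i, j)"
        by (metis mult.assoc)
    qed
    also have "\<dots> = (\<integral>\<^sup>+kl. F kl \<partial>l)"
      unfolding nn_integral_measure_pmf by (subst nn_integral_fst_count_space) simp
    finally show ?thesis .
  qed
  ultimately show thesis ..
qed

section \<open>Nearly geodesic chains along a finite grid of times\<close>

text \<open>
  Replacing both points by points at distance \<open>\<epsilon>\<close> changes the distance by at most \<open>2\<epsilon>\<close>. The bound is kept
  linear in the squared distance so that it can be integrated.
\<close>

lemma dist_sq_perturb:
  fixes x x' y y' :: "'a::metric_space"
  assumes "dist x x' < \<epsilon>" "dist y y' < \<epsilon>"
  shows "(dist x y)\<^sup>2 \<le> (1 + \<epsilon>) * ((dist x' y')\<^sup>2 + 4 * \<epsilon>)"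
proof -
  have "\<epsilon> > 0"
    using assms(1) zero_le_dist[of x x'] by linarith
  have "dist x y \<le> dist x x' + dist x' y' + dist y y'"
    using dist_triangle[of x y x'] dist_triangle[of x' y y'] by (simp add: dist_commute)
  then have "dist x y \<le> dist x' y' + 2 * \<epsilon>"
    using assms by linarith
  then have "(dist x y)\<^sup>2 \<le> (dist x' y' + 2 * \<epsilon>)\<^sup>2"
    by (intro power_mono) auto
  also have "\<dots> = (1 + \<epsilon>) * ((dist x' y')\<^sup>2 + 4 * \<epsilon>) - \<epsilon> * (dist x' y' - 2)\<^sup>2"
    by (simp add: power2_eq_square algebra_simps)
  also have "\<dots> \<le> (1 + \<epsilon>) * ((dist x' y')\<^sup>2 + 4 * \<epsilon>)"
    using \<open>\<epsilon> > 0\<close> by simp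
  finally show ?thesis .
qed

text \<open>
  The defect in the Cauchy-Schwarz inequality as a sum of squares: it shows that a chain whose energy
  is nearly minimal moves at nearly constant speed.
\<close>

lemma weighted_square_defect:
  fixes f \<Delta> :: "'i \<Rightarrow> real"
  assumes "\<And>i. i \<in> I \<Longrightarrow> \<Delta> i > 0" "(\<Sum>i\<in>I. \<Delta> i) = 1"
  shows "(\<Sum>i\<in>I. (f i)\<^sup>2 / \<Delta> i) - (\<Sum>i\<in>I. f i)\<^sup>2
       = (\<Sum>i\<in>I. (f i - \<Delta> i * (\<Sum>i\<in>I. f i))\<^sup>2 / \<Delta> i)"
proof -
  define F where "F = (\<Sum>i\<in>I. f i)"
  have "(\<Sum>i\<in>I. (f i - \<Delta> i * F)\<^sup>2 / \<Delta> i) = (\<Sum>i\<in>I. (f i)\<^sup>2 / \<Delta> i - 2 * F * f i + F\<^sup>2 * \<Delta> i)"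
  proof (intro sum.cong refl)
    fix i assume "i \<in> I"
    then have "\<Delta> i > 0" by (rule assms)
    then show "(f i - \<Delta> i * F)\<^sup>2 / \<Delta> i = (f i)\<^sup>2 / \<Delta> i - 2 * F * f i + F\<^sup>2 * \<Delta> i"
      by (simp add: field_simps power2_eq_square)
  qed
  also have "\<dots> = (\<Sum>i\<in>I. (f i)\<^sup>2 / \<Delta> i) - 2 * F * F + F\<^sup>2 * 1"
    by (simp add: sum.distrib sum_subtractf F_def assms(2) flip: sum_distrib_left)
  finally show ?thesis
    by (simp add: F_def power2_eq_square)
qed

lemma dist_le_chain_length: "dist (y m) (y (m + k)) \<le> (\<Sum>i\<in>{m..<m+k}. dist (y i) (y (Suc i)))"
proof (induction k)
  case (Suc k)
  have "dist (y m) (y (m + Suc k)) \<le> dist (y m) (y (m + k)) + dist (y (m + k)) (y (Suc (m + k)))"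
    using dist_triangle[of "y m" "y (Suc (m + k))" "y (m + k)"] by simp
  with Suc.IH show ?case by simp
qed simp

lemma sq_dist_le_chain_energy:
  fixes y :: "nat \<Rightarrow> 'a::metric_space"
  assumes "\<And>i. i < n \<Longrightarrow> \<Delta> i > 0" "(\<Sum>i<n. \<Delta> i) = 1"
  shows "(dist (y 0) (y n))\<^sup>2 \<le> (\<Sum>i<n. (dist (y i) (y (Suc i)))\<^sup>2 / \<Delta> i)"
proof -
  have "dist (y 0) (y n) \<le> (\<Sum>i<n. dist (y i) (y (Suc i)))"
    using dist_le_chain_length[of y 0 n] by (simp add: atLeast0LessThan)
  then have "(dist (y 0) (y n))\<^sup>2 \<le> (\<Sum>i<n. dist (y i) (y (Suc i)))\<^sup>2"
    by (intro power_mono) auto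
  moreover have "0 \<le> (\<Sum>i<n. (dist (y i) (y (Suc i))
      - \<Delta> i * (\<Sum>i<n. dist (y i) (y (Suc i))))\<^sup>2 / \<Delta> i)"
    using assms(1) by (intro sum_nonneg divide_nonneg_nonneg) (auto simp: less_imp_le)
  ultimately show ?thesis
    using weighted_square_defect[of "{..<n}" \<Delta> "\<lambda>i. dist (y i) (y (Suc i))"] assms by simp
qed

lemma nn_integral_dist_sq_perturb:
  fixes u v u' v' :: "'b \<Rightarrow> 'a::polish_space"
  assumes "prob_space M" and [measurable]: "u' \<in> borel_measurable M" "v' \<in> borel_measurable M"
    and "\<epsilon> > 0" "\<And>z. dist (u z) (u' z) < \<epsilon>" "\<And>z. dist (v z) (v' z) < \<epsilon>"
  shows "(\<integral>\<^sup>+z. ennreal ((dist (u z) (v z))\<^sup>2) \<partial>M)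
    \<le> ennreal (1 + \<epsilon>) * ((\<integral>\<^sup>+z. ennreal ((dist (u' z) (v' z))\<^sup>2) \<partial>M) + ennreal (4 * \<epsilon>))"
proof -
  interpret prob_space M by fact
  have "(\<integral>\<^sup>+z. ennreal ((dist (u z) (v z))\<^sup>2) \<partial>M)
      \<le> (\<integral>\<^sup>+z. ennreal (1 + \<epsilon>) * (ennreal ((dist (u' z) (v' z))\<^sup>2) + ennreal (4 * \<epsilon>)) \<partial>M)"
  proof (rule nn_integral_mono)
    fix z
    have "(dist (u z) (v z))\<^sup>2 \<le> (1 + \<epsilon>) * ((dist (u' z) (v' z))\<^sup>2 + 4 * \<epsilon>)"
      by (rule dist_sq_perturb) fact+
    then show "ennreal ((dist (u z) (v z))\<^sup>2)
        \<le> ennreal (1 + \<epsilon>) * (ennreal ((dist (u' z) (v' z))\<^sup>2) + ennreal (4 * \<epsilon>))"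
      using \<open>\<epsilon> > 0\<close> by (simp flip: ennreal_plus ennreal_mult')
  qed
  also have "\<dots> = ennreal (1 + \<epsilon>) * ((\<integral>\<^sup>+z. ennreal ((dist (u' z) (v' z))\<^sup>2) \<partial>M) + ennreal (4 * \<epsilon>))"
    by (simp add: nn_integral_cmult nn_integral_add emeasure_space_1)
  finally show ?thesis .
qed

text \<open>
  The hypotheses say that consecutive measures are at Wasserstein distance \<open>\<Delta>\<^sub>i W\<close> at most and the end
  measures at distance \<open>W\<close> at least. If no chain through the sets \<open>K\<^sub>i\<close> had energy within \<open>\<delta>\<close> of the squared end
  distance, the random chain would waste energy \<open>\<delta>\<close> on an event whose probability is at least some \<open>c > 0\<close>
  independent of the mesh \<open>\<epsilon>\<close>, whereas the waste must vanish as \<open>\<epsilon> \<longrightarrow> 0\<close>.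
\<close>

lemma exists_near_geodesic_chain:
  fixes \<mu> :: "nat \<Rightarrow> 'a::polish_space measure" and s :: "nat \<Rightarrow> real"
  assumes prob: "\<And>i. i \<le> n \<Longrightarrow> prob_space (\<mu> i)"
    and sets: "\<And>i. i \<le> n \<Longrightarrow> sets (\<mu> i) = sets borel"
    and \<Delta>: "\<And>i. i < n \<Longrightarrow> \<Delta> i > 0" "(\<Sum>i<n. \<Delta> i) = 1"
    and short: "\<And>i \<epsilon>. i < n \<Longrightarrow> \<epsilon> > 0 \<Longrightarrow> \<exists>\<pi>\<in>couplings (\<mu> i) (\<mu> (Suc i)).
        (\<integral>\<^sup>+(x, y). ennreal ((dist x y)\<^sup>2) \<partial>\<pi>) \<le> ennreal ((\<Delta> i * W + \<epsilon>)\<^sup>2)"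
    and long: "\<And>\<pi>. \<pi> \<in> couplings (\<mu> 0) (\<mu> n) \<Longrightarrow>
        ennreal (W\<^sup>2) \<le> (\<integral>\<^sup>+(x, y). ennreal ((dist x y)\<^sup>2) \<partial>\<pi>)"
    and K: "\<And>i. i \<le> n \<Longrightarrow> K i \<in> sets borel" "(\<Sum>i\<le>n. measure (\<mu> i) (- K i)) < 1"
    and "\<delta> > 0"
  obtains y where "\<And>i. i \<le> n \<Longrightarrow> y i \<in> K i"
    "(\<Sum>i<n. (dist (y i) (y (Suc i)))\<^sup>2 / \<Delta> i) \<le> (dist (y 0) (y n))\<^sup>2 + \<delta>"
proof -
  define T where "T = (\<Sum>i<n. 1 / \<Delta> i)"
  define c where "c = 1 - (\<Sum>i\<le>n. measure (\<mu> i) (- K i))"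
  \<comment> \<open>\<open>R \<epsilon>\<close> bounds the mean energy of the discretised chain and \<open>B \<epsilon>\<close> adds the discretisation errors;
    at \<open>\<epsilon> = 0\<close> both equal \<open>W\<^sup>2\<close>.\<close>
  define R where "R \<epsilon> = (\<Sum>i<n. (1 + \<epsilon>) * ((\<Delta> i * W + \<epsilon>)\<^sup>2 + 4 * \<epsilon>) / \<Delta> i)" for \<epsilon>
  define B where "B \<epsilon> = (1 + \<epsilon>)\<^sup>2 * R \<epsilon> + ((1 + \<epsilon>)\<^sup>2 * (4 * \<epsilon> * T) + 4 * \<epsilon> * (1 + \<epsilon>))" for \<epsilon>
  have "T \<ge> 0"
    unfolding T_def using \<Delta>(1) by (intro sum_nonneg) (simp add: less_imp_le)
  have "c > 0"
    using K by (simp add: c_def)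
  { assume no: "\<nexists>y. (\<forall>i\<le>n. y i \<in> K i) \<and>
      (\<Sum>i<n. (dist (y i) (y (Suc i)))\<^sup>2 / \<Delta> i) \<le> (dist (y 0) (y n))\<^sup>2 + \<delta>"
    have bound: "W\<^sup>2 \<le> (1 + \<epsilon>) * (B \<epsilon> - \<delta> * c + 4 * \<epsilon>)" if "\<epsilon> > 0" for \<epsilon>
    proof -
      obtain q :: "'a \<Rightarrow> nat" and r where q[measurable]: "q \<in> measurable borel (count_space UNIV)"
        and r: "\<And>x. dist x (r (q x)) < \<epsilon>"
        using countable_discretisation[OF \<open>\<epsilon> > 0\<close>] by metis
      have "\<forall>i. \<exists>\<pi>. i < n \<longrightarrow> \<pi> \<in> couplings (\<mu> i) (\<mu> (Suc i)) \<and>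
        (\<integral>\<^sup>+(x, y). ennreal ((dist x y)\<^sup>2) \<partial>\<pi>) \<le> ennreal ((\<Delta> i * W + \<epsilon>)\<^sup>2)"
        using short[OF _ \<open>\<epsilon> > 0\<close>] by blast
      then obtain \<pi> where \<pi>: "\<And>i. i < n \<Longrightarrow> \<pi> i \<in> couplings (\<mu> i) (\<mu> (Suc i))"
        and \<pi>_cost: "\<And>i. i < n \<Longrightarrow>
          (\<integral>\<^sup>+(x, y). ennreal ((dist x y)\<^sup>2) \<partial>\<pi> i) \<le> ennreal ((\<Delta> i * W + \<epsilon>)\<^sup>2)"
        by metis
      have \<pi>_sets: "sets (\<pi> i) = sets borel" "distr (\<pi> i) borel fst = \<mu> i"
        "distr (\<pi> i) borel snd = \<mu> (Suc i)" if "i < n" for i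
        using \<pi>[OF that] by (auto simp: couplings_def)
      have meas_fst_snd[measurable]: "fst \<in> measurable (\<pi> i) borel" "snd \<in> measurable (\<pi> i) borel"
        if "i < n" for i
        using \<pi>_sets(1)[OF that] by (auto cong: measurable_cong_sets simp: borel_prod[symmetric])
      have \<pi>_prob: "prob_space (\<pi> i)" if "i < n" for i
        using prob[of i] that \<pi>_sets(2)[OF that]
        by (intro prob_space_distrD[OF meas_fst_snd(1)[OF that]]) simp
      have "\<exists>p. i < n \<longrightarrow> measure_pmf p = distr (\<pi> i) (count_space UNIV) (\<lambda>z. (q (fst z), q (snd z)))" for i
      proof (cases "i < n")
        case True
        note [measurable] = meas_fst_snd[OF True]
        have "(\<lambda>z. (q (fst z), q (snd z))) \<in> measurable (\<pi> i) (count_space UNIV)"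
          by measurable
        with pmf_of_law[OF \<pi>_prob[OF True] this] show ?thesis by metis
      qed simp
      then obtain p where p: "\<And>i. i < n \<Longrightarrow>
        measure_pmf (p i) = distr (\<pi> i) (count_space UNIV) (\<lambda>z. (q (fst z), q (snd z)))"
        by metis
      have q_meas: "q \<in> measurable (\<mu> i) (count_space UNIV)" if "i \<le> n" for i
        using sets[OF that] by (simp cong: measurable_cong_sets)
      have "\<exists>p. i \<le> n \<longrightarrow> measure_pmf p = distr (\<mu> i) (count_space UNIV) q" for i
        using pmf_of_law[OF prob q_meas] by metis
      then obtain \<nu> where \<nu>: "\<And>i. i \<le> n \<Longrightarrow> measure_pmf (\<nu> i) = distr (\<mu> i) (count_space UNIV) q"
        by metis
      have p_fst: "map_pmf fst (p i) = \<nu> i" and p_snd: "map_pmf snd (p i) = \<nu> (Suc i)" if "i < n" for i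
      proof -
        note [measurable] = meas_fst_snd[OF that]
        have "measure_pmf (map_pmf fst (p i)) = distr (distr (\<pi> i) borel fst) (count_space UNIV) q"
          unfolding map_pmf_rep_eq p[OF that] by (simp add: distr_distr comp_def)
        then show "map_pmf fst (p i) = \<nu> i"
          using that by (simp add: \<pi>_sets \<nu> flip: measure_pmf_inject)
        have "measure_pmf (map_pmf snd (p i)) = distr (distr (\<pi> i) borel snd) (count_space UNIV) q"
          unfolding map_pmf_rep_eq p[OF that] by (simp add: distr_distr comp_def)
        then show "map_pmf snd (p i) = \<nu> (Suc i)"
          using that by (simp add: \<pi>_sets \<nu> flip: measure_pmf_inject)
      qed
      obtain Q :: "(nat \<Rightarrow> nat) pmf" where Q: "\<And>i. i < n \<Longrightarrow> map_pmf (\<lambda>f. (f i, f (Suc i))) Q = p i"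
        and Q_marg: "\<And>i. i \<le> n \<Longrightarrow> map_pmf (\<lambda>f. f i) Q = \<nu> i"
        using markov_chain_of_couplings[of n p \<nu>, OF p_fst p_snd] by blast
      define D where "D f = (dist (r (f 0)) (r (f n)))\<^sup>2" for f
      define S where "S f = (\<Sum>i<n. (dist (r (f i)) (r (f (Suc i))))\<^sup>2 / \<Delta> i)" for f
      have S_nonneg: "S f \<ge> 0" for f
        unfolding S_def using \<Delta>(1) by (intro sum_nonneg) (simp add: less_imp_le)
      have D_le_S: "D f \<le> S f" for f
        using sq_dist_le_chain_energy[OF \<Delta>, of "\<lambda>i. r (f i)"] by (simp add: D_def S_def)
      have R_nonneg: "R \<epsilon> \<ge> 0"
        unfolding R_def using \<Delta>(1) \<open>\<epsilon> > 0\<close> by (intro sum_nonneg) (simp add: less_imp_le)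
      have S_mean: "(\<integral>\<^sup>+f. ennreal (S f) \<partial>Q) \<le> ennreal (R \<epsilon>)"
      proof -
        have summand: "(\<integral>\<^sup>+f. ennreal ((dist (r (f i)) (r (f (Suc i))))\<^sup>2 / \<Delta> i) \<partial>Q)
            \<le> ennreal ((1 + \<epsilon>) * ((\<Delta> i * W + \<epsilon>)\<^sup>2 + 4 * \<epsilon>) / \<Delta> i)" if "i < n" for i
        proof -
          note [measurable] = meas_fst_snd[OF that]
          have "(\<integral>\<^sup>+f. ennreal ((dist (r (f i)) (r (f (Suc i))))\<^sup>2) \<partial>Q)
              = (\<integral>\<^sup>+kl. ennreal ((dist (r (fst kl)) (r (snd kl)))\<^sup>2) \<partial>p i)"
            by (simp flip: Q[OF that])
          also have "\<dots> = (\<integral>\<^sup>+z. ennreal ((dist (r (q (fst z))) (r (q (snd z))))\<^sup>2) \<partial>\<pi> i)"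
            unfolding p[OF that] by (subst nn_integral_distr) auto
          also have "\<dots> \<le> ennreal (1 + \<epsilon>) *
              ((\<integral>\<^sup>+z. ennreal ((dist (fst z) (snd z))\<^sup>2) \<partial>\<pi> i) + ennreal (4 * \<epsilon>))"
            using r \<open>\<epsilon> > 0\<close>
            by (intro nn_integral_dist_sq_perturb \<pi>_prob that) (auto simp: dist_commute)
          also have "\<dots> \<le> ennreal (1 + \<epsilon>) * (ennreal ((\<Delta> i * W + \<epsilon>)\<^sup>2) + ennreal (4 * \<epsilon>))"
            using \<pi>_cost[OF that]
            by (intro mult_left_mono add_right_mono) (auto simp: case_prod_unfold)
          also have "\<dots> = ennreal ((1 + \<epsilon>) * ((\<Delta> i * W + \<epsilon>)\<^sup>2 + 4 * \<epsilon>))"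
            using \<open>\<epsilon> > 0\<close> by (simp flip: ennreal_plus ennreal_mult')
          finally have *: "(\<integral>\<^sup>+f. ennreal ((dist (r (f i)) (r (f (Suc i))))\<^sup>2) \<partial>Q)
              \<le> ennreal ((1 + \<epsilon>) * ((\<Delta> i * W + \<epsilon>)\<^sup>2 + 4 * \<epsilon>))" .
          have "(\<integral>\<^sup>+f. ennreal ((dist (r (f i)) (r (f (Suc i))))\<^sup>2 / \<Delta> i) \<partial>Q)
              = ennreal (1 / \<Delta> i) * (\<integral>\<^sup>+f. ennreal ((dist (r (f i)) (r (f (Suc i))))\<^sup>2) \<partial>Q)"
            using \<Delta>(1)[OF that]
            by (subst nn_integral_cmult[symmetric]) (auto simp flip: ennreal_mult' intro!: nn_integral_cong)
          also have "\<dots> \<le> ennreal (1 / \<Delta> i) * ennreal ((1 + \<epsilon>) * ((\<Delta> i * W + \<epsilon>)\<^sup>2 + 4 * \<epsilon>))"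
            by (intro mult_left_mono *) auto
          also have "\<dots> = ennreal ((1 + \<epsilon>) * ((\<Delta> i * W + \<epsilon>)\<^sup>2 + 4 * \<epsilon>) / \<Delta> i)"
            using \<Delta>(1)[OF that] by (simp flip: ennreal_mult')
          finally show ?thesis .
        qed
        have "(\<integral>\<^sup>+f. ennreal (S f) \<partial>Q)
            = (\<Sum>i<n. \<integral>\<^sup>+f. ennreal ((dist (r (f i)) (r (f (Suc i))))\<^sup>2 / \<Delta> i) \<partial>Q)"
          unfolding S_def using \<Delta>(1)
          by (subst nn_integral_sum[symmetric]) (auto simp: less_imp_le intro!: nn_integral_cong sum_ennreal[symmetric])
        also have "\<dots> \<le> (\<Sum>i<n. ennreal ((1 + \<epsilon>) * ((\<Delta> i * W + \<epsilon>)\<^sup>2 + 4 * \<epsilon>) / \<Delta> i))"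
          by (intro sum_mono summand) auto
        also have "\<dots> = ennreal (R \<epsilon>)"
          unfolding R_def using \<Delta>(1) \<open>\<epsilon> > 0\<close> by (intro sum_ennreal) (simp add: less_imp_le)
        finally show ?thesis .
      qed
      have D_mean: "ennreal (W\<^sup>2) \<le> ennreal (1 + \<epsilon>) * ((\<integral>\<^sup>+f. ennreal (D f) \<partial>Q) + ennreal (4 * \<epsilon>))"
      proof -
        define l where "l = map_pmf (\<lambda>f. (f 0, f n)) Q"
        have "map_pmf fst l = \<nu> 0" "map_pmf snd l = \<nu> n"
          using Q_marg[of 0] Q_marg[of n] by (simp_all add: l_def map_pmf_comp)
        then obtain \<pi>' where \<pi>': "\<pi>' \<in> couplings (\<mu> 0) (\<mu> n)"
          and law: "\<And>F :: nat \<times> nat \<Rightarrow> ennreal. (\<integral>\<^sup>+z. F (q (fst z), q (snd z)) \<partial>\<pi>') = (\<integral>\<^sup>+kl. F kl \<partial>l)"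
          using coupling_with_discretised_law[of "\<mu> 0" "\<mu> n" q l] prob sets q \<nu> by auto
        have \<pi>'_sets: "sets \<pi>' = sets borel" "distr \<pi>' borel fst = \<mu> 0"
          using \<pi>' by (auto simp: couplings_def)
        have [measurable]: "fst \<in> measurable \<pi>' borel" "snd \<in> measurable \<pi>' borel"
          using \<pi>'_sets(1) by (auto cong: measurable_cong_sets simp: borel_prod[symmetric])
        have "prob_space \<pi>'"
          using prob[of 0] \<pi>'_sets(2) by (intro prob_space_distrD[of fst \<pi>' borel]) auto
        have "ennreal (W\<^sup>2) \<le> (\<integral>\<^sup>+z. ennreal ((dist (fst z) (snd z))\<^sup>2) \<partial>\<pi>')"
          using long[OF \<pi>'] by (simp add: case_prod_unfold)
        also have "\<dots> \<le> ennreal (1 + \<epsilon>) *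
            ((\<integral>\<^sup>+z. ennreal ((dist (r (q (fst z))) (r (q (snd z))))\<^sup>2) \<partial>\<pi>') + ennreal (4 * \<epsilon>))"
          using r \<open>\<epsilon> > 0\<close> \<open>prob_space \<pi>'\<close> by (intro nn_integral_dist_sq_perturb) auto
        also have "(\<integral>\<^sup>+z. ennreal ((dist (r (q (fst z))) (r (q (snd z))))\<^sup>2) \<partial>\<pi>')
            = (\<integral>\<^sup>+f. ennreal (D f) \<partial>Q)"
          using law[of "\<lambda>kl. ennreal ((dist (r (fst kl)) (r (snd kl)))\<^sup>2)"] by (simp add: l_def D_def)
        finally show ?thesis .
      qed
      \<comment> \<open>The event that every cell of the chain meets its set \<open>K i\<close>.\<close>
      define G where "G = {f. \<forall>i\<le>n. f i \<in> q ` K i}"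
      have G_prob: "measure_pmf.prob Q G \<ge> c"
      proof -
        have "measure_pmf.prob Q (- G) \<le> measure_pmf.prob Q (\<Union>i\<in>{..n}. {f. f i \<notin> q ` K i})"
          by (intro measure_pmf.finite_measure_mono) (auto simp: G_def)
        also have "\<dots> \<le> (\<Sum>i\<le>n. measure_pmf.prob Q {f. f i \<notin> q ` K i})"
          by (intro measure_pmf.finite_measure_subadditive_finite) auto
        also have "\<dots> \<le> (\<Sum>i\<le>n. measure (\<mu> i) (- K i))"
        proof (rule sum_mono)
          fix i assume "i \<in> {..n}"
          then have i: "i \<le> n" by simp
          interpret \<mu>: prob_space "\<mu> i" using prob[OF i] .
          note [measurable_cong] = sets[OF i]
          have [measurable]: "K i \<in> sets borel" using K i by blast
          have "measure_pmf.prob Q {f. f i \<notin> q ` K i} = measure_pmf.prob (\<nu> i) (- (q ` K i))"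
            unfolding Q_marg[OF i, symmetric] by (simp add: vimage_def)
          also have "\<dots> = measure (\<mu> i) (q -` (- (q ` K i)) \<inter> space (\<mu> i))"
            unfolding \<nu>[OF i] by (rule measure_distr) auto
          also have "\<dots> \<le> measure (\<mu> i) (- K i)"
            by (intro \<mu>.finite_measure_mono) (auto simp: sets[OF i])
          finally show "measure_pmf.prob Q {f. f i \<notin> q ` K i} \<le> measure (\<mu> i) (- K i)" .
        qed
        also have "\<dots> = 1 - c" by (simp add: c_def)
        finally show ?thesis
          using measure_pmf.prob_compl[of G Q] by (simp add: Compl_eq_Diff_UNIV)
      qed
      have pointwise: "D f + \<delta> * indicator G f \<le>
          (1 + \<epsilon>)\<^sup>2 * S f + ((1 + \<epsilon>)\<^sup>2 * (4 * \<epsilon> * T) + 4 * \<epsilon> * (1 + \<epsilon>))" for f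
      proof (cases "f \<in> G")
        case True
        then have "\<forall>i. \<exists>y. i \<le> n \<longrightarrow> y \<in> K i \<and> q y = f i"
          unfolding G_def by force
        then obtain y where y: "\<And>i. i \<le> n \<Longrightarrow> y i \<in> K i" "\<And>i. i \<le> n \<Longrightarrow> q (y i) = f i"
          by metis
        define d where "d = (dist (y 0) (y n))\<^sup>2"
        have near: "dist (y i) (r (f i)) < \<epsilon>" if "i \<le> n" for i
          using r[of "y i"] y(2)[OF that] by simp
        have "d + \<delta> < (\<Sum>i<n. (dist (y i) (y (Suc i)))\<^sup>2 / \<Delta> i)"
          using no y(1) unfolding d_def by (meson not_le)
        also have "\<dots> \<le> (\<Sum>i<n. (1 + \<epsilon>) * ((dist (r (f i)) (r (f (Suc i))))\<^sup>2 + 4 * \<epsilon>) / \<Delta> i)"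
          using near \<Delta>(1)
          by (intro sum_mono divide_right_mono dist_sq_perturb) (auto simp: less_imp_le)
        also have "\<dots> = (1 + \<epsilon>) * (S f + 4 * \<epsilon> * T)"
          unfolding S_def T_def sum_distrib_left sum.distrib[symmetric]
          by (intro sum.cong) (auto simp: add_divide_distrib distrib_left)
        finally have 1: "d + \<delta> \<le> (1 + \<epsilon>) * (S f + 4 * \<epsilon> * T)" by simp
        have "D f \<le> (1 + \<epsilon>) * (d + 4 * \<epsilon>)"
          unfolding D_def d_def using near by (intro dist_sq_perturb) (auto simp: dist_commute)
        moreover have "\<delta> \<le> (1 + \<epsilon>) * \<delta>"
          using \<open>\<delta> > 0\<close> \<open>\<epsilon> > 0\<close> by simp
        ultimately have "D f + \<delta> \<le> (1 + \<epsilon>) * (d + \<delta>) + 4 * \<epsilon> * (1 + \<epsilon>)"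
          by (simp add: algebra_simps)
        also have "\<dots> \<le> (1 + \<epsilon>) * ((1 + \<epsilon>) * (S f + 4 * \<epsilon> * T)) + 4 * \<epsilon> * (1 + \<epsilon>)"
          using \<open>\<epsilon> > 0\<close> by (intro add_right_mono mult_left_mono 1) auto
        finally show ?thesis
          using True by (simp add: power2_eq_square algebra_simps)
      next
        case False
        have "1 * S f \<le> (1 + \<epsilon>)\<^sup>2 * S f"
          using \<open>\<epsilon> > 0\<close> S_nonneg by (intro mult_right_mono) auto
        moreover have "0 \<le> (1 + \<epsilon>)\<^sup>2 * (4 * \<epsilon> * T) + 4 * \<epsilon> * (1 + \<epsilon>)"
          using \<open>\<epsilon> > 0\<close> \<open>T \<ge> 0\<close> by simp
        ultimately show ?thesis
          using False D_le_S[of f] by simp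
      qed
      define C where "C = (1 + \<epsilon>)\<^sup>2 * (4 * \<epsilon> * T) + 4 * \<epsilon> * (1 + \<epsilon>)"
      have "C \<ge> 0"
        using \<open>T \<ge> 0\<close> \<open>\<epsilon> > 0\<close> by (simp add: C_def)
      have "(\<integral>\<^sup>+f. ennreal (D f) \<partial>Q) + ennreal (\<delta> * c)
          \<le> (\<integral>\<^sup>+f. ennreal (D f) \<partial>Q) + ennreal \<delta> * emeasure Q G"
        using G_prob \<open>\<delta> > 0\<close> \<open>c > 0\<close>
        by (auto simp: measure_pmf.emeasure_eq_measure simp flip: ennreal_mult' intro!: add_left_mono)
      also have "\<dots> = (\<integral>\<^sup>+f. ennreal (D f + \<delta> * indicator G f) \<partial>Q)"
        using \<open>\<delta> > 0\<close>
        by (simp add: D_def ennreal_plus nn_integral_add nn_integral_cmult ennreal_mult ennreal_indicator del: ennreal_plus[symmetric])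
      also have "\<dots> \<le> (\<integral>\<^sup>+f. ennreal ((1 + \<epsilon>)\<^sup>2 * S f + C) \<partial>Q)"
        using pointwise by (intro nn_integral_mono ennreal_leI) (simp add: C_def)
      also have "\<dots> = ennreal ((1 + \<epsilon>)\<^sup>2) * (\<integral>\<^sup>+f. ennreal (S f) \<partial>Q) + ennreal C"
        using S_nonneg \<open>C \<ge> 0\<close>
        by (simp add: nn_integral_add nn_integral_cmult ennreal_mult)
      also have "\<dots> \<le> ennreal ((1 + \<epsilon>)\<^sup>2) * ennreal (R \<epsilon>) + ennreal C"
        by (intro add_right_mono mult_left_mono S_mean) auto
      also have "\<dots> = ennreal (B \<epsilon>)"
        using R_nonneg \<open>C \<ge> 0\<close> by (simp add: B_def C_def[symmetric] ennreal_mult)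
      finally have *: "(\<integral>\<^sup>+f. ennreal (D f) \<partial>Q) + ennreal (\<delta> * c) \<le> ennreal (B \<epsilon>)" .
      then have "(\<integral>\<^sup>+f. ennreal (D f) \<partial>Q) \<noteq> \<infinity>"
        by (auto simp: top_unique)
      then obtain D0 where D0: "D0 \<ge> 0" "(\<integral>\<^sup>+f. ennreal (D f) \<partial>Q) = ennreal D0"
        by (cases "\<integral>\<^sup>+f. ennreal (D f) \<partial>Q") auto
      have "B \<epsilon> \<ge> 0"
        using R_nonneg \<open>C \<ge> 0\<close> by (simp add: B_def C_def[symmetric])
      with * D0 have "D0 + \<delta> * c \<le> B \<epsilon>"
        using \<open>\<delta> > 0\<close> \<open>c > 0\<close> by (simp flip: ennreal_plus)
      moreover have "W\<^sup>2 \<le> (1 + \<epsilon>) * (D0 + 4 * \<epsilon>)"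
        using D_mean D0 \<open>\<epsilon> > 0\<close> by (simp flip: ennreal_plus ennreal_mult')
      moreover have "(1 + \<epsilon>) * (D0 + 4 * \<epsilon>) \<le> (1 + \<epsilon>) * (B \<epsilon> - \<delta> * c + 4 * \<epsilon>)"
        using calculation(1) \<open>\<epsilon> > 0\<close> by (intro mult_left_mono) auto
      ultimately show ?thesis by linarith
    qed
    have "(\<Sum>i<n. (1 + 0) * ((\<Delta> i * W + 0)\<^sup>2 + 4 * 0) / \<Delta> i) = W\<^sup>2"
    proof -
      have "(\<Sum>i<n. (1 + 0) * ((\<Delta> i * W + 0)\<^sup>2 + 4 * 0) / \<Delta> i) = (\<Sum>i<n. \<Delta> i * W\<^sup>2)"
        using \<Delta>(1) by (intro sum.cong) (auto simp: power2_eq_square)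
      then show ?thesis
        using \<Delta>(2) by (simp flip: sum_distrib_right)
    qed
    then have "((\<lambda>\<epsilon>. (1 + \<epsilon>) * (B \<epsilon> - \<delta> * c + 4 * \<epsilon>)) \<longlongrightarrow> W\<^sup>2 - \<delta> * c) (at_right 0)"
      unfolding B_def R_def using less_imp_neq[OF \<Delta>(1)] by (auto intro!: tendsto_eq_intros)
    \<comment> \<open>Letting the mesh \<open>\<epsilon>\<close> of the partition tend to \<open>0\<close>.\<close>
    then have "W\<^sup>2 \<le> W\<^sup>2 - \<delta> * c"
      by (rule tendsto_lowerbound) (use bound in \<open>auto simp: eventually_at_right_less intro!: eventually_at_rightI[of 0 1]\<close>)
    then have False
      using mult_pos_pos[OF \<open>\<delta> > 0\<close> \<open>c > 0\<close>] by simp }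
  then show thesis
    using that by blast
qed

text \<open>
  Almost equality in Cauchy-Schwarz bounds every step from above; the lower bound for the distance
  of two points comes from the upper bounds for the rest of the chain and the triangle inequality.
\<close>

lemma chain_near_geodesic:
  fixes z :: "nat \<Rightarrow> 'a::metric_space" and s :: "nat \<Rightarrow> real"
  assumes s: "s 0 = 0" "s n = 1" "\<And>i. i < n \<Longrightarrow> s i < s (Suc i)"
    and energy: "(\<Sum>i<n. (dist (z i) (z (Suc i)))\<^sup>2 / (s (Suc i) - s i)) \<le> (dist (z 0) (z n))\<^sup>2 + e\<^sup>2"
    and "e \<ge> 0" "i \<le> j" "j \<le> n"
  shows "\<bar>dist (z i) (z j) - (s j - s i) * dist (z 0) (z n)\<bar> \<le> (real n + 1) * e"
proof -
  define f where "f i = dist (z i) (z (Suc i))" for i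
  define \<Delta> where "\<Delta> i = s (Suc i) - s i" for i
  define F where "F = (\<Sum>i<n. f i)"
  define L where "L = dist (z 0) (z n)"
  have \<Delta>_pos: "\<Delta> i > 0" if "i < n" for i
    using s(3)[OF that] by (simp add: \<Delta>_def)
  have \<Delta>_sum: "(\<Sum>i\<in>{a..<a+k}. \<Delta> i) = s (a + k) - s a" for a k
    by (induction k) (auto simp: \<Delta>_def)
  have mono: "s a \<le> s b" if "a \<le> b" "b \<le> n" for a b
    using that
  proof (induction b rule: dec_induct)
    case (step k)
    then show ?case
      using s(3)[of k] by auto
  qed simp
  have total: "(\<Sum>i<n. \<Delta> i) = 1"
    using \<Delta>_sum[of 0 n] s by (simp add: atLeast0LessThan)
  have "L \<le> F"
    using dist_le_chain_length[of z 0 n] by (simp add: L_def F_def f_def atLeast0LessThan)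
  then have "L\<^sup>2 \<le> F\<^sup>2"
    by (intro power_mono) (auto simp: L_def)
  have defect: "(\<Sum>i<n. (f i)\<^sup>2 / \<Delta> i) - F\<^sup>2 = (\<Sum>i<n. (f i - \<Delta> i * F)\<^sup>2 / \<Delta> i)"
    using weighted_square_defect[of "{..<n}" \<Delta> f] \<Delta>_pos total by (simp add: F_def)
  have "(\<Sum>i<n. (f i)\<^sup>2 / \<Delta> i) \<le> L\<^sup>2 + e\<^sup>2"
    using energy by (simp add: f_def \<Delta>_def L_def)
  with defect \<open>L\<^sup>2 \<le> F\<^sup>2\<close> have defect_le: "(\<Sum>i<n. (f i - \<Delta> i * F)\<^sup>2 / \<Delta> i) \<le> e\<^sup>2"
    by linarith
  have defect_nonneg: "0 \<le> (f i - \<Delta> i * F)\<^sup>2 / \<Delta> i" if "i < n" for i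
    using \<Delta>_pos[OF that] by simp
  have "0 \<le> (\<Sum>i<n. (f i - \<Delta> i * F)\<^sup>2 / \<Delta> i)"
    by (intro sum_nonneg defect_nonneg) auto
  with defect \<open>(\<Sum>i<n. (f i)\<^sup>2 / \<Delta> i) \<le> L\<^sup>2 + e\<^sup>2\<close> have "F\<^sup>2 \<le> L\<^sup>2 + e\<^sup>2"
    by linarith
  also have "\<dots> \<le> (L + e)\<^sup>2"
    using \<open>e \<ge> 0\<close> by (simp add: power2_sum L_def)
  finally have "F \<le> L + e"
    by (rule power2_le_imp_le) (use \<open>e \<ge> 0\<close> in \<open>simp add: L_def\<close>)
  have f_le: "f i \<le> \<Delta> i * (L + e) + e" if "i < n" for i
  proof -
    have "(f i - \<Delta> i * F)\<^sup>2 / \<Delta> i \<le> (\<Sum>i<n. (f i - \<Delta> i * F)\<^sup>2 / \<Delta> i)"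
      using that by (intro member_le_sum defect_nonneg) auto
    with defect_le have "(f i - \<Delta> i * F)\<^sup>2 / \<Delta> i \<le> e\<^sup>2" by linarith
    then have "(f i - \<Delta> i * F)\<^sup>2 \<le> \<Delta> i * e\<^sup>2"
      using \<Delta>_pos[OF that] by (simp add: field_simps)
    also have "\<Delta> i \<le> (\<Sum>i<n. \<Delta> i)"
      using that by (intro member_le_sum) (auto intro: less_imp_le \<Delta>_pos)
    then have "\<Delta> i * e\<^sup>2 \<le> 1 * e\<^sup>2"
      by (intro mult_right_mono) (auto simp: total)
    finally have "f i - \<Delta> i * F \<le> e"
      using \<open>e \<ge> 0\<close> by (intro power2_le_imp_le[of "f i - \<Delta> i * F"]) auto
    moreover have "\<Delta> i * F \<le> \<Delta> i * (L + e)"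
      using \<Delta>_pos[OF that] \<open>F \<le> L + e\<close> by (intro mult_left_mono) auto
    ultimately show ?thesis by linarith
  qed
  have upper: "dist (z a) (z b) \<le> (s b - s a) * L + (s b - s a + (real b - real a)) * e"
    if "a \<le> b" "b \<le> n" for a b
  proof -
    have "dist (z a) (z (a + (b - a))) \<le> (\<Sum>i\<in>{a..<a+(b-a)}. f i)"
      unfolding f_def by (rule dist_le_chain_length)
    also have "\<dots> \<le> (\<Sum>i\<in>{a..<a+(b-a)}. \<Delta> i * (L + e) + e)"
      using that by (intro sum_mono f_le) auto
    also have "\<dots> = (s b - s a) * (L + e) + real (b - a) * e"
      using \<Delta>_sum[of a "b - a"] that by (simp add: sum.distrib flip: sum_distrib_right)
    finally show ?thesis
      using that by (simp add: algebra_simps of_nat_diff)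
  qed
  have "s 0 \<le> s i" "s i \<le> s j" "s j \<le> s n"
    using assms(6,7) by (auto intro!: mono)
  then have sij: "0 \<le> s i" "s i \<le> s j" "s j \<le> 1"
    using s by auto
  have "dist (z i) (z j) \<le> (s j - s i) * L + (s j - s i + (real j - real i)) * e"
    using assms(6,7) by (rule upper)
  also have "(s j - s i + (real j - real i)) * e \<le> (real n + 1) * e"
    using sij assms(6,7) \<open>e \<ge> 0\<close> by (intro mult_right_mono) auto
  finally have "dist (z i) (z j) - (s j - s i) * L \<le> (real n + 1) * e" by simp
  moreover have "(s j - s i) * L - dist (z i) (z j) \<le> (real n + 1) * e"
  proof -
    have "L \<le> dist (z 0) (z i) + dist (z i) (z j) + dist (z j) (z n)"
      using dist_triangle[of "z 0" "z n" "z i"] dist_triangle[of "z i" "z n" "z j"] by (simp add: L_def)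
    moreover have "dist (z 0) (z i) \<le> s i * L + (s i + real i) * e"
      using upper[of 0 i] assms(6,7) s by simp
    moreover have "dist (z j) (z n) \<le> (1 - s j) * L + (1 - s j + (real n - real j)) * e"
      using upper[of j n] assms(6,7) s by simp
    ultimately have "(s j - s i) * L - dist (z i) (z j) \<le> (s i + real i + (1 - s j + (real n - real j))) * e"
      by (simp add: algebra_simps)
    also have "\<dots> \<le> (real n + 1) * e"
      using sij assms(6,7) \<open>e \<ge> 0\<close> by (intro mult_right_mono) auto
    finally show ?thesis .
  qed
  ultimately show ?thesis
    by (simp add: L_def abs_le_iff)
qed

lemma finite_grid_enumeration:
  fixes F :: "real set"
  assumes "finite F" "F \<subseteq> {0..1}" "0 \<in> F" "1 \<in> F"
  obtains n and s :: "nat \<Rightarrow> real" where "s ` {..n} = F" "s 0 = 0" "s n = 1"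
    "\<And>i j. i < j \<Longrightarrow> j \<le> n \<Longrightarrow> s i < s j"
proof -
  define xs where "xs = sorted_list_of_set F"
  define n where "n = length xs - 1"
  have xs: "set xs = F" "sorted_wrt (<) xs"
    using assms by (auto simp: xs_def)
  have len: "length xs = Suc n"
    using xs assms by (cases xs) (auto simp: n_def)
  have img: "(!) xs ` {..n} = F"
    using xs(1) len by (auto simp: set_conv_nth less_Suc_eq_le image_iff)
  have mono: "xs ! i < xs ! j" if "i < j" "j \<le> n" for i j
    using that xs(2) len by (auto intro: sorted_wrt_nth_less)
  have "xs ! 0 = 0"
  proof (rule ccontr)
    assume "xs ! 0 \<noteq> 0"
    moreover obtain k where "k \<le> n" "xs ! k = 0"
      using img assms(3) by (metis (no_types, lifting) atMost_iff imageE)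
    ultimately have "xs ! 0 < 0"
      using mono[of 0 k] by (cases k) auto
    moreover have "xs ! 0 \<in> F"
      using img by force
    ultimately show False
      using assms(2) by auto
  qed
  moreover have "xs ! n = 1"
  proof (rule ccontr)
    assume "xs ! n \<noteq> 1"
    moreover obtain k where "k \<le> n" "xs ! k = 1"
      using img assms(4) by (metis (no_types, lifting) atMost_iff imageE)
    ultimately have "xs ! n > 1"
      using mono[of k n] by (cases "k = n") auto
    moreover have "xs ! n \<in> F"
      using img by force
    ultimately show False
      using assms(2) by auto
  qed
  ultimately show thesis
    using that[of "(!) xs" n] img mono by blast
qed

section \<open>Wasserstein distances and costs of couplings\<close>

lemma transport_cost_finite:
  assumes "(\<integral>\<^sup>+(x, y). ennreal ((dist x y)\<^sup>2) \<partial>\<pi>) = ennreal u" "u \<ge> 0"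
  shows "transport_cost \<pi> = ennreal (sqrt u)"
  using assms by (auto simp: transport_cost_def enn_powr_def powr_half_sqrt)

text \<open>
  The costs of couplings are handled through the integral of the squared distance, which,
  unlike \<open>transport_cost\<close>, is linear in the coupling.
\<close>

lemma W2_squared_le_cost:
  assumes "\<pi> \<in> couplings \<mu> \<nu>"
  shows "ennreal ((enn2real (W2 \<mu> \<nu>))\<^sup>2) \<le> (\<integral>\<^sup>+(x, y). ennreal ((dist x y)\<^sup>2) \<partial>\<pi>)"
proof (cases "\<integral>\<^sup>+(x, y). ennreal ((dist x y)\<^sup>2) \<partial>\<pi>")
  case (real u)
  have "W2 \<mu> \<nu> \<le> transport_cost \<pi>"
    unfolding W2_def using assms by (rule INF_lower)
  then have "W2 \<mu> \<nu> \<le> ennreal (sqrt u)"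
    using transport_cost_finite[OF real(2,1)] by simp
  then have "enn2real (W2 \<mu> \<nu>) \<le> sqrt u"
    using real(1) by (intro enn2real_leI) auto
  then have "(enn2real (W2 \<mu> \<nu>))\<^sup>2 \<le> (sqrt u)\<^sup>2"
    by (intro power_mono) auto
  then show ?thesis
    using real by (auto intro: ennreal_leI)
qed simp

lemma exists_near_optimal_coupling:
  assumes "W2 \<mu> \<nu> < \<infinity>" "\<epsilon> > 0"
  shows "\<exists>\<pi>\<in>couplings \<mu> \<nu>. (\<integral>\<^sup>+(x, y). ennreal ((dist x y)\<^sup>2) \<partial>\<pi>)
           \<le> ennreal ((enn2real (W2 \<mu> \<nu>) + \<epsilon>)\<^sup>2)"
proof -
  define w where "w = enn2real (W2 \<mu> \<nu>)"
  have w: "W2 \<mu> \<nu> = ennreal w" "w \<ge> 0"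
    using assms(1) by (auto simp: w_def)
  then have "(INF \<pi>\<in>couplings \<mu> \<nu>. transport_cost \<pi>) < ennreal (w + \<epsilon>)"
    using \<open>\<epsilon> > 0\<close> by (simp add: W2_def[symmetric] ennreal_less_iff)
  then obtain \<pi> where \<pi>: "\<pi> \<in> couplings \<mu> \<nu>" "transport_cost \<pi> < ennreal (w + \<epsilon>)"
    by (auto simp: INF_less_iff)
  have "(\<integral>\<^sup>+(x, y). ennreal ((dist x y)\<^sup>2) \<partial>\<pi>) \<le> ennreal ((w + \<epsilon>)\<^sup>2)"
  proof (cases "\<integral>\<^sup>+(x, y). ennreal ((dist x y)\<^sup>2) \<partial>\<pi>")
    case (real u)
    then have "sqrt u < w + \<epsilon>"
      using \<pi>(2) transport_cost_finite[OF real(2,1)] by (simp add: ennreal_less_iff)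
    then have "(sqrt u)\<^sup>2 \<le> (w + \<epsilon>)\<^sup>2"
      using real(1) by (intro power_mono) auto
    then show ?thesis
      using real by (auto intro: ennreal_leI)
  next
    case top
    then show ?thesis
      using \<pi>(2) by (simp add: transport_cost_def enn_powr_def)
  qed
  with \<pi>(1) show ?thesis by (auto simp: w_def)
qed

text \<open>
  The geodesic relation is stated for \<open>enn2real (W2 \<mu> \<nu>)\<close>, which forgets infinite values; finiteness,
  witnessed by the product coupling, makes it a statement about \<open>W2\<close>.
\<close>

lemma W2_finite_on_P2:
  assumes "\<mu> \<in> P2" "\<nu> \<in> P2"
  shows "W2 \<mu> \<nu> < \<infinity>"
proof -
  obtain a where a: "(\<integral>\<^sup>+x. ennreal ((dist a x)\<^sup>2) \<partial>\<mu>) < \<infinity>"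
    using assms(1) by (auto simp: P2_def)
  obtain b where b: "(\<integral>\<^sup>+x. ennreal ((dist b x)\<^sup>2) \<partial>\<nu>) < \<infinity>"
    using assms(2) by (auto simp: P2_def)
  have sets[measurable_cong]: "sets \<mu> = sets borel" "sets \<nu> = sets borel"
    using assms by (auto simp: P2_def)
  interpret \<mu>: prob_space \<mu> using assms(1) by (auto simp: P2_def)
  interpret \<nu>: prob_space \<nu> using assms(2) by (auto simp: P2_def)
  interpret P: pair_prob_space \<mu> \<nu> ..
  let ?\<pi> = "\<mu> \<Otimes>\<^sub>M \<nu>"
  have "distr ?\<pi> borel fst = distr ?\<pi> \<mu> fst" "distr ?\<pi> borel snd = distr ?\<pi> \<nu> snd"
    by (auto intro!: distr_cong simp: sets)
  moreover have fst_marg: "distr ?\<pi> \<mu> fst = \<mu>"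
    by (rule \<nu>.distr_pair_fst)
  moreover have snd_marg: "distr ?\<pi> \<nu> snd = \<nu>"
  proof (rule measure_eqI)
    fix A assume A: "A \<in> sets (distr ?\<pi> \<nu> snd)"
    then have "emeasure (distr ?\<pi> \<nu> snd) A = emeasure ?\<pi> (space \<mu> \<times> A)"
      by (auto simp: emeasure_distr space_pair_measure dest: sets.sets_into_space
          intro!: arg_cong2[where f=emeasure])
    with A show "emeasure (distr ?\<pi> \<nu> snd) A = emeasure \<nu> A"
      by (simp add: \<nu>.emeasure_pair_measure_Times \<mu>.emeasure_space_1)
  qed simp
  moreover have "sets ?\<pi> = sets (borel :: ('a \<times> 'a) measure)"
    unfolding borel_prod[symmetric] by (intro sets_pair_measure_cong) fact+
  ultimately have coupling: "?\<pi> \<in> couplings \<mu> \<nu>"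
    by (simp add: couplings_def)
  have fst_int: "(\<integral>\<^sup>+z. ennreal ((dist a (fst z))\<^sup>2) \<partial>?\<pi>) = (\<integral>\<^sup>+x. ennreal ((dist a x)\<^sup>2) \<partial>\<mu>)"
    using nn_integral_distr[of fst ?\<pi> \<mu> "\<lambda>x. ennreal ((dist a x)\<^sup>2)"] by (simp add: fst_marg)
  have snd_int: "(\<integral>\<^sup>+z. ennreal ((dist b (snd z))\<^sup>2) \<partial>?\<pi>) = (\<integral>\<^sup>+y. ennreal ((dist b y)\<^sup>2) \<partial>\<nu>)"
    using nn_integral_distr[of snd ?\<pi> \<nu> "\<lambda>y. ennreal ((dist b y)\<^sup>2)"] by (simp add: snd_marg)
  have "(\<integral>\<^sup>+(x, y). ennreal ((dist x y)\<^sup>2) \<partial>?\<pi>)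
      \<le> (\<integral>\<^sup>+z. 3 * (ennreal ((dist a (fst z))\<^sup>2) + ennreal ((dist a b)\<^sup>2) + ennreal ((dist b (snd z))\<^sup>2)) \<partial>?\<pi>)"
  proof (rule nn_integral_mono)
    fix z :: "'a \<times> 'a"
    obtain x y where z: "z = (x, y)" by (cases z)
    have "dist x y \<le> dist a x + dist a b + dist b y"
      using dist_triangle[of x y a] dist_triangle[of a y b] by (simp add: dist_commute)
    then have "(dist x y)\<^sup>2 \<le> (dist a x + dist a b + dist b y)\<^sup>2"
      by (intro power_mono) auto
    also have "\<dots> \<le> 3 * ((dist a x)\<^sup>2 + (dist a b)\<^sup>2 + (dist b y)\<^sup>2)"
      using sum_squares_bound[of "dist a x" "dist a b"] sum_squares_bound[of "dist a x" "dist b y"]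
        sum_squares_bound[of "dist a b" "dist b y"]
      by (simp add: power2_eq_square algebra_simps)
    finally have "ennreal ((dist x y)\<^sup>2) \<le> ennreal (3 * ((dist a x)\<^sup>2 + (dist a b)\<^sup>2 + (dist b y)\<^sup>2))"
      by (rule ennreal_leI)
    then show "(case z of (x, y) \<Rightarrow> ennreal ((dist x y)\<^sup>2))
        \<le> 3 * (ennreal ((dist a (fst z))\<^sup>2) + ennreal ((dist a b)\<^sup>2) + ennreal ((dist b (snd z))\<^sup>2))"
      by (simp add: z ennreal_mult)
  qed
  also have "\<dots> = 3 * ((\<integral>\<^sup>+x. ennreal ((dist a x)\<^sup>2) \<partial>\<mu>) + ennreal ((dist a b)\<^sup>2)
      + (\<integral>\<^sup>+y. ennreal ((dist b y)\<^sup>2) \<partial>\<nu>))"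
    using fst_int snd_int by (simp add: nn_integral_cmult nn_integral_add P.emeasure_space_1)
  also have "\<dots> < \<infinity>"
    using a b by (simp add: ennreal_mult_less_top)
  finally have "transport_cost ?\<pi> < \<infinity>"
    by (auto simp: transport_cost_def enn_powr_def)
  moreover have "W2 \<mu> \<nu> \<le> transport_cost ?\<pi>"
    unfolding W2_def using coupling by (rule INF_lower)
  ultimately show ?thesis
    by (rule order_le_less_trans[rotated])
qed

section \<open>Concentration of Wasserstein geodesics on intermediate points\<close>

lemma W2_geodesic_near_geodesic_points:
  fixes \<mu> :: "real \<Rightarrow> 'a::polish_space measure"
  assumes \<mu>: "W2_geodesic \<mu>" and F: "finite F" "F \<subseteq> {0..1}" "0 \<in> F" "1 \<in> F"
    and K: "\<And>t. t \<in> F \<Longrightarrow> K t \<in> sets borel" "(\<Sum>t\<in>F. measure (\<mu> t) (- K t)) < 1"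
    and "\<delta> > 0"
  shows "\<exists>y. (\<forall>t\<in>F. y t \<in> K t) \<and>
    (\<forall>t\<in>F. \<forall>u\<in>F. \<bar>dist (y t) (y u) - \<bar>t - u\<bar> * dist (y 0) (y 1)\<bar> \<le> \<delta>)"
proof -
  obtain n and s :: "nat \<Rightarrow> real" where s: "s ` {..n} = F" "s 0 = 0" "s n = 1"
    and s_mono: "\<And>i j. i < j \<Longrightarrow> j \<le> n \<Longrightarrow> s i < s j"
    using finite_grid_enumeration[OF F] by metis
  have s_in: "s i \<in> {0..1}" "s i \<in> F" if "i \<le> n" for i
    using s(1) F(2) that by auto
  have s_inj: "inj_on s {..n}"
    by (rule linorder_inj_onI) (use s_mono in \<open>force+\<close>)
  \<comment> \<open>A chain with energy excess \<open>e\<^sup>2\<close> is geodesic up to \<open>(n + 1) * e\<close>.\<close>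
  define e where "e = \<delta> / (real n + 1)"
  have "e > 0"
    using \<open>\<delta> > 0\<close> by (simp add: e_def)
  define W where "W = enn2real (W2 (\<mu> 0) (\<mu> 1))"
  have P2: "\<mu> t \<in> P2" if "t \<in> {0..1}" for t
    using \<mu> that by (auto simp: W2_geodesic_def)
  have W2: "enn2real (W2 (\<mu> t) (\<mu> u)) = \<bar>t - u\<bar> * W" if "t \<in> {0..1}" "u \<in> {0..1}" for t u
    using \<mu> that unfolding W2_geodesic_def minimal_geodesic_def W_def by blast
  have sum_\<Delta>: "(\<Sum>i<n. s (Suc i) - s i) = 1"
    using s by (simp add: sum_lessThan_telescope)
  have short: "\<exists>\<pi>\<in>couplings (\<mu> (s i)) (\<mu> (s (Suc i))).
      (\<integral>\<^sup>+(x, y). ennreal ((dist x y)\<^sup>2) \<partial>\<pi>) \<le> ennreal (((s (Suc i) - s i) * W + \<epsilon>)\<^sup>2)"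
    if "i < n" "\<epsilon> > 0" for i \<epsilon>
  proof -
    have in01: "s i \<in> {0..1}" "s (Suc i) \<in> {0..1}"
      using s_in(1)[of i] s_in(1)[of "Suc i"] that by auto
    have "enn2real (W2 (\<mu> (s i)) (\<mu> (s (Suc i)))) = (s (Suc i) - s i) * W"
      using W2[OF in01] s_mono[of i "Suc i"] that by simp
    then show ?thesis
      using exists_near_optimal_coupling[OF W2_finite_on_P2[OF P2[OF in01(1)] P2[OF in01(2)]] \<open>\<epsilon> > 0\<close>]
      by simp
  qed
  have long: "ennreal (W\<^sup>2) \<le> (\<integral>\<^sup>+(x, y). ennreal ((dist x y)\<^sup>2) \<partial>\<pi>)"
    if "\<pi> \<in> couplings (\<mu> (s 0)) (\<mu> (s n))" for \<pi>
    using W2_squared_le_cost[OF that] s by (simp add: W_def)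
  have mass: "(\<Sum>i\<le>n. measure (\<mu> (s i)) (- K (s i))) < 1"
    using K(2) sum.reindex[OF s_inj, of "\<lambda>t. measure (\<mu> t) (- K t)"] s(1) by (simp add: comp_def)
  obtain z where z: "\<And>i. i \<le> n \<Longrightarrow> z i \<in> K (s i)"
    and energy: "(\<Sum>i<n. (dist (z i) (z (Suc i)))\<^sup>2 / (s (Suc i) - s i)) \<le> (dist (z 0) (z n))\<^sup>2 + e\<^sup>2"
  proof (rule exists_near_geodesic_chain[of n "\<lambda>i. \<mu> (s i)" "\<lambda>i. s (Suc i) - s i" W "\<lambda>i. K (s i)" "e\<^sup>2"])
    show "prob_space (\<mu> (s i))" "sets (\<mu> (s i)) = sets borel" if "i \<le> n" for i
      using P2[OF s_in(1)[OF that]] by (auto simp: P2_def)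
  qed (use short long mass sum_\<Delta> K(1) s_in \<open>e > 0\<close> s_mono in auto)
  define y where "y t = z (inv_into {..n} s t)" for t
  have y_s: "y (s i) = z i" if "i \<le> n" for i
    using that by (simp add: y_def inv_into_f_f[OF s_inj])
  have "y 0 = z 0" "y 1 = z n"
    using y_s[of 0] y_s[of n] s by auto
  have ordered: "\<bar>dist (z i) (z j) - \<bar>s i - s j\<bar> * dist (z 0) (z n)\<bar> \<le> \<delta>" if "i \<le> j" "j \<le> n" for i j
  proof -
    have "s i \<le> s j"
      using s_mono[of i j] that by (cases "i = j") auto
    moreover have "\<bar>dist (z i) (z j) - (s j - s i) * dist (z 0) (z n)\<bar> \<le> (real n + 1) * e"
      using s s_mono energy \<open>e > 0\<close> that by (intro chain_near_geodesic) auto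
    ultimately show ?thesis
      by (simp add: e_def)
  qed
  have "\<bar>dist (y (s i)) (y (s j)) - \<bar>s i - s j\<bar> * dist (y 0) (y 1)\<bar> \<le> \<delta>" if "i \<le> n" "j \<le> n" for i j
    using ordered[of i j] ordered[of j i] that
    by (cases "i \<le> j") (simp_all add: y_s \<open>y 0 = z 0\<close> \<open>y 1 = z n\<close> dist_commute abs_minus_commute)
  then show ?thesis
    using s(1) z by (intro exI[of _ y]) (auto simp: y_s simp flip: s(1))
qed

text \<open>
  The geodesic relation up to \<open>\<delta>\<close> at a pair of times is a closed condition on the compact product of
  the sets \<open>K t\<close>, so by compactness all these conditions can be met at once.
\<close>

lemma geodesic_relation_from_finite_approximations:
  fixes K :: "real \<Rightarrow> 'a::metric_space set"
  assumes D: "0 \<in> D" "1 \<in> D" and K: "\<And>t. t \<in> D \<Longrightarrow> compact (K t)"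
    and approx: "\<And>F \<delta>. finite F \<Longrightarrow> F \<subseteq> D \<Longrightarrow> 0 \<in> F \<Longrightarrow> 1 \<in> F \<Longrightarrow> \<delta> > 0 \<Longrightarrow>
      \<exists>y. (\<forall>t\<in>F. y t \<in> K t) \<and>
        (\<forall>t\<in>F. \<forall>u\<in>F. \<bar>dist (y t) (y u) - \<bar>t - u\<bar> * dist (y 0) (y 1)\<bar> \<le> \<delta>)"
  shows "\<exists>y. (\<forall>t\<in>D. y t \<in> K t) \<and> (\<forall>t\<in>D. \<forall>u\<in>D. dist (y t) (y u) = \<bar>t - u\<bar> * dist (y 0) (y 1))"
proof -
  \<comment> \<open>Outside the given times the factor is a singleton, so that the product stays compact.\<close>
  define P where "P = PiE UNIV (\<lambda>t. if t \<in> D then K t else {undefined})"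
  define C where "C = (\<lambda>(t, u, \<delta>). {y :: real \<Rightarrow> 'a. \<bar>dist (y t) (y u) - \<bar>t - u\<bar> * dist (y 0) (y 1)\<bar> \<le> \<delta>})"
  define I where "I = D \<times> D \<times> {0 :: real<..}"
  have "compactin (product_topology (\<lambda>_. euclidean) UNIV) P"
    unfolding P_def compactin_PiE using K by auto
  then have "compact P"
    by (simp add: euclidean_product_topology)
  have "P \<inter> \<Inter>(C ` I) \<noteq> {}"
  proof (rule compact_imp_fip_image[OF \<open>compact P\<close>])
    fix i assume "i \<in> I"
    show "closed (C i)"
      unfolding C_def by (cases i) (auto intro!: closed_Collect_le continuous_intros continuous_on_product_coordinates)
  next
    fix J assume J: "finite J" "J \<subseteq> I"
    define F where "F = {0, 1} \<union> fst ` J \<union> (fst \<circ> snd) ` J"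
    define \<delta> where "\<delta> = Min (insert 1 ((snd \<circ> snd) ` J))"
    have F: "finite F" "F \<subseteq> D" "0 \<in> F" "1 \<in> F"
      using J D by (auto simp: F_def I_def)
    have "\<delta> > 0"
      using J by (auto simp: \<delta>_def I_def)
    with approx[OF F] obtain y where y: "\<And>t. t \<in> F \<Longrightarrow> y t \<in> K t"
      "\<And>t u. t \<in> F \<Longrightarrow> u \<in> F \<Longrightarrow> \<bar>dist (y t) (y u) - \<bar>t - u\<bar> * dist (y 0) (y 1)\<bar> \<le> \<delta>"
      by metis
    have nonempty: "\<exists>x. x \<in> K t" if "t \<in> D" for t
      using approx[of "{0, 1, t}" 1] D that by auto
    define y' where "y' t = (if t \<in> F then y t else if t \<in> D then (SOME x. x \<in> K t) else undefined)" for t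
    have "y' \<in> P"
      using y(1) F(2) someI_ex[OF nonempty] by (auto simp: P_def y'_def)
    moreover have "y' \<in> C i" if "i \<in> J" for i
    proof -
      obtain t u d where i: "i = (t, u, d)" by (cases i)
      have "t \<in> F" "u \<in> F"
        using that by (force simp: F_def i)+
      moreover have "\<delta> \<le> d"
        unfolding \<delta>_def using J that by (intro Min_le) (force simp: i)+
      ultimately show ?thesis
        using y(2)[of t u] F by (auto simp: C_def i y'_def)
    qed
    ultimately show "P \<inter> \<Inter>(C ` J) \<noteq> {}" by blast
  qed
  then obtain y where y: "y \<in> P" "\<And>i. i \<in> I \<Longrightarrow> y \<in> C i" by blast
  have "dist (y t) (y u) = \<bar>t - u\<bar> * dist (y 0) (y 1)" if "t \<in> D" "u \<in> D" for t u
  proof -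
    have "\<bar>dist (y t) (y u) - \<bar>t - u\<bar> * dist (y 0) (y 1)\<bar> \<le> 0 + \<delta>" if "\<delta> > 0" for \<delta>
      using y(2)[of "(t, u, \<delta>)"] \<open>t \<in> D\<close> \<open>u \<in> D\<close> that by (simp add: C_def I_def)
    then have "\<bar>dist (y t) (y u) - \<bar>t - u\<bar> * dist (y 0) (y 1)\<bar> \<le> 0"
      by (rule field_le_epsilon)
    then show ?thesis by simp
  qed
  moreover have "y t \<in> K t" if "t \<in> D" for t
    using y(1) that by (auto simp: P_def PiE_iff split: if_splits)
  ultimately show ?thesis by blast
qed

text \<open>
  A map with the geodesic relation is Lipschitz, so completeness extends it to the closure of its
  times, and the relation survives by continuity.
\<close>

lemma extend_geodesic_from_dense:
  fixes y :: "real \<Rightarrow> 'a::complete_space"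
  assumes D: "D \<subseteq> {0..1}" "{0..1} \<subseteq> closure D" "0 \<in> D" "1 \<in> D"
    and y: "\<And>t u. t \<in> D \<Longrightarrow> u \<in> D \<Longrightarrow> dist (y t) (y u) = \<bar>t - u\<bar> * dist (y 0) (y 1)"
  obtains \<gamma> where "minimal_geodesic dist \<gamma>" "\<And>t. t \<in> D \<Longrightarrow> \<gamma> t = y t"
proof -
  define L where "L = dist (y 0) (y 1)"
  have "L-lipschitz_on D y"
    using y by (intro lipschitz_onI) (auto simp: L_def dist_real_def mult.commute)
  then have "uniformly_continuous_on D y"
    by (rule lipschitz_on_uniformly_continuous)
  then obtain g where g: "uniformly_continuous_on (closure D) g" "\<And>x. x \<in> D \<Longrightarrow> y x = g x"
    by (rule uniformly_continuous_on_extension_on_closure) blast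
  have cont: "continuous_on (closure D) g"
    using g(1) by (rule uniformly_continuous_imp_continuous)
  have on_D: "dist (g t) (g u) - \<bar>t - u\<bar> * L = 0" if "t \<in> D" "u \<in> D" for t u
  proof -
    have "dist (g t) (g u) = dist (y t) (y u)"
      using g(2) that by simp
    then show ?thesis
      by (simp only: y[OF that] L_def diff_self)
  qed
  have *: "dist (g t) (g u) - \<bar>t - u\<bar> * L = 0" if "t \<in> D" "u \<in> closure D" for t u
  proof (rule continuous_constant_on_closure[of D "\<lambda>u. dist (g t) (g u) - \<bar>t - u\<bar> * L"])
    show "continuous_on (closure D) (\<lambda>u. dist (g t) (g u) - \<bar>t - u\<bar> * L)"
      by (intro continuous_intros cont)
  qed (use that on_D in auto)
  have full: "dist (g t) (g u) - \<bar>t - u\<bar> * L = 0" if "t \<in> closure D" "u \<in> closure D" for t u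
  proof (rule continuous_constant_on_closure[of D "\<lambda>t. dist (g t) (g u) - \<bar>t - u\<bar> * L"])
    show "continuous_on (closure D) (\<lambda>t. dist (g t) (g u) - \<bar>t - u\<bar> * L)"
      by (intro continuous_intros cont)
  qed (use that * in auto)
  have "dist (g 0) (g 1) = L"
    using g(2)[OF D(3)] g(2)[OF D(4)] by (simp add: L_def)
  then have "dist (g t) (g u) = \<bar>t - u\<bar> * dist (g 0) (g 1)" if "t \<in> {0..1}" "u \<in> {0..1}" for t u
    using full[OF subsetD[OF D(2) that(1)] subsetD[OF D(2) that(2)]] by simp
  then have "minimal_geodesic dist g"
    unfolding minimal_geodesic_def by blast
  with g(2) that show thesis by metis
qed

lemma exists_compact_of_small_complement:
  fixes M :: "'a::polish_space measure"
  assumes "prob_space M" "sets M = sets borel" "B \<in> sets borel" "measure M B = 1" "\<eta> > 0"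
  shows "\<exists>C\<subseteq>B. compact C \<and> measure M (- C) < \<eta>"
proof -
  interpret prob_space M by fact
  have sp: "space M = UNIV"
    using sets_eq_imp_space_eq[OF assms(2)] by simp
  have "ennreal (1 - \<eta>) < emeasure M B"
    using assms(4,5) by (simp add: emeasure_eq_measure ennreal_less_one_iff)
  also have "emeasure M B = (SUP C \<in> {C. C \<subseteq> B \<and> compact C}. emeasure M C)"
    by (rule inner_regular) (use assms in auto)
  finally obtain C where C: "C \<subseteq> B" "compact C" "ennreal (1 - \<eta>) < emeasure M C"
    by (auto simp: less_SUP_iff)
  have "C \<in> events"
    using C(2) assms(2) by (simp add: borel_compact)
  then have "measure M (- C) = 1 - measure M C"
    using prob_compl[of C] sp by (simp add: Compl_eq_Diff_UNIV)
  moreover have "1 - \<eta> < measure M C"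
    using C(3) unfolding emeasure_eq_measure by (meson ennreal_leI not_le)
  ultimately show ?thesis
    using C by auto
qed

lemma sum_half_powers_le_1:
  fixes f :: "'b \<Rightarrow> nat"
  assumes "finite F" "inj_on f F"
  shows "(\<Sum>t\<in>F. (1 / 2 :: real) ^ Suc (f t)) \<le> 1"
proof -
  have "(\<Sum>t\<in>F. (1 / 2 :: real) ^ Suc (f t)) = (\<Sum>k\<in>f ` F. (1 / 2) ^ Suc k)"
    using assms(2) by (simp add: sum.reindex)
  also have "\<dots> \<le> (\<Sum>k. (1 / 2) ^ Suc k)"
    using assms(1) power_half_series by (intro sum_le_suminf) (auto simp: sums_iff)
  also have "\<dots> = 1"
    using power_half_series by (simp add: sums_iff)
  finally show ?thesis .
qed

text \<open>
  If \<open>\<mu> t\<close> charged a compact set outside \<open>E\<close>, there would be a geodesic from \<open>A\<^sub>0\<close> to \<open>A\<^sub>1\<close> that lies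
  in this compact set at time \<open>t\<close>. Only Borel sets \<open>E\<close> are considered, since the set of intermediate points need not be
  measurable.
\<close>

lemma W2_geodesic_concentrated_on_intermediate_set:
  fixes \<mu> :: "real \<Rightarrow> 'a::polish_space measure"
  assumes \<mu>: "W2_geodesic \<mu>" and t: "t \<in> {0..1}"
    and A: "A\<^sub>0 \<in> sets borel" "A\<^sub>1 \<in> sets borel" "measure (\<mu> 0) A\<^sub>0 = 1" "measure (\<mu> 1) A\<^sub>1 = 1"
    and E: "E \<in> sets borel" "intermediate_set A\<^sub>0 A\<^sub>1 t \<subseteq> E"
  shows "measure (\<mu> t) E = 1"
proof (rule ccontr)
  assume "measure (\<mu> t) E \<noteq> 1"
  have prob: "prob_space (\<mu> u)" and sets: "sets (\<mu> u) = sets borel" if "u \<in> {0..1}" for u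
    using \<mu> that by (auto simp: W2_geodesic_def P2_def)
  have sp: "space (\<mu> u) = UNIV" if "u \<in> {0..1}" for u
    using sets_eq_imp_space_eq[OF sets[OF that]] by simp
  interpret T: prob_space "\<mu> t" using prob[OF t] .
  have "measure (\<mu> t) E < 1"
    using \<open>measure (\<mu> t) E \<noteq> 1\<close> T.prob_le_1[of E] by linarith
  then have "measure (\<mu> t) (- E) > 0"
    using T.prob_compl[of E] E(1) sets[OF t] sp[OF t]
    by (simp add: Compl_eq_Diff_UNIV)
  then have "0 < emeasure (\<mu> t) (- E)"
    by (simp add: T.emeasure_eq_measure)
  also have "emeasure (\<mu> t) (- E) = (SUP C \<in> {C. C \<subseteq> - E \<and> compact C}. emeasure (\<mu> t) C)"
    by (rule inner_regular) (use E sets[OF t] in auto)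
  finally obtain C where C: "C \<subseteq> - E" "compact C" "0 < emeasure (\<mu> t) C"
    by (auto simp: less_SUP_iff)
  define c where "c = measure (\<mu> t) C"
  have "c > 0"
    using C(3) by (simp add: c_def T.emeasure_eq_measure)
  have "c \<le> 1"
    unfolding c_def by (rule T.prob_le_1)
  have C_compl: "measure (\<mu> t) (- C) = 1 - c"
    using T.prob_compl[of C] C(2) sets[OF t] sp[OF t] by (simp add: Compl_eq_Diff_UNIV c_def borel_compact)
  define D where "D = {0..1} \<inter> \<rat> \<union> {t}"
  have D: "D \<subseteq> {0..1}" "0 \<in> D" "1 \<in> D" "t \<in> D" "countable D"
    using t by (auto simp: D_def intro: countable_subset[OF _ countable_rat])
  have dense: "{0..1} \<subseteq> closure D"
  proof -
    have "closure ({0..1} \<inter> \<rat>) = closure {0..1 :: real}"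
      by (rule closure_convex_Int_superset) (auto simp: Rats_closure_real)
    then show ?thesis
      using closure_mono[of "{0..1} \<inter> \<rat>" D] closure_subset by (auto simp: D_def)
  qed
  \<comment> \<open>The constraint at time \<open>u\<close>, and a summable family of tolerances with sum at most \<open>c / 2\<close>.
    The constraint at time \<open>t\<close>, which may be an end point, is imposed in addition.\<close>
  define B where "B u = (if u = 0 then A\<^sub>0 else if u = 1 then A\<^sub>1 else UNIV)" for u :: real
  define \<eta> where "\<eta> u = c / 2 * (1 / 2) ^ Suc (to_nat_on D u)" for u
  have "\<exists>H\<subseteq>B u. compact H \<and> measure (\<mu> u) (- H) < \<eta> u" if "u \<in> {0..1}" for u
  proof (rule exists_compact_of_small_complement[OF prob[OF that] sets[OF that]])
    show "measure (\<mu> u) (B u) = 1"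
      using prob_space.prob_space[OF prob[OF that]] A sp[OF that] by (auto simp: B_def)
  qed (use A \<open>c > 0\<close> in \<open>auto simp: B_def \<eta>_def\<close>)
  then obtain H where H: "\<And>u. u \<in> {0..1} \<Longrightarrow> H u \<subseteq> B u" "\<And>u. u \<in> {0..1} \<Longrightarrow> compact (H u)"
    "\<And>u. u \<in> {0..1} \<Longrightarrow> measure (\<mu> u) (- H u) < \<eta> u"
    by metis
  define K where "K u = (if u = t then H u \<inter> C else H u)" for u
  have K: "compact (K u)" if "u \<in> {0..1}" for u
    using H(2)[OF that] C(2) by (auto simp: K_def intro: compact_Int)
  have K_mass: "measure (\<mu> u) (- K u) \<le> \<eta> u + (if u = t then 1 - c else 0)" if "u \<in> {0..1}" for u
  proof (cases "u = t")
    case True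
    have "measure (\<mu> t) (- H t \<union> - C) \<le> measure (\<mu> t) (- H t) + measure (\<mu> t) (- C)"
      by (intro measure_Un_le) (simp_all only: sets[OF t] borel_comp borel_compact H(2)[OF t] C(2))
    also have "\<dots> \<le> \<eta> t + (1 - c)"
      using H(3)[OF t] C_compl by linarith
    finally show ?thesis
      unfolding True by (simp add: K_def)
  qed (use H(3)[OF that] in \<open>simp add: K_def\<close>)
  have "\<exists>y. (\<forall>u\<in>D. y u \<in> K u) \<and> (\<forall>u\<in>D. \<forall>v\<in>D. dist (y u) (y v) = \<bar>u - v\<bar> * dist (y 0) (y 1))"
  proof (rule geodesic_relation_from_finite_approximations)
    fix F and \<delta> :: real assume F: "finite F" "F \<subseteq> D" "0 \<in> F" "1 \<in> F" and "\<delta> > 0"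
    have "(\<Sum>u\<in>F. measure (\<mu> u) (- K u)) \<le> (\<Sum>u\<in>F. \<eta> u + (if u = t then 1 - c else 0))"
      using F D by (intro sum_mono K_mass) auto
    also have "\<dots> = (\<Sum>u\<in>F. \<eta> u) + (if t \<in> F then 1 - c else 0)"
      using F(1) by (simp add: sum.distrib)
    also have "(\<Sum>u\<in>F. \<eta> u) \<le> c / 2 * 1"
      unfolding \<eta>_def sum_distrib_left[symmetric]
      using \<open>c > 0\<close> F D inj_on_subset[OF inj_on_to_nat_on[OF D(5)] F(2)]
      by (intro mult_left_mono sum_half_powers_le_1) auto
    finally have "(\<Sum>u\<in>F. measure (\<mu> u) (- K u)) \<le> c / 2 + (if t \<in> F then 1 - c else 0)" by simp
    also have "\<dots> < 1"
      using \<open>c > 0\<close> \<open>c \<le> 1\<close> by auto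
    finally show "\<exists>y. (\<forall>u\<in>F. y u \<in> K u) \<and>
        (\<forall>u\<in>F. \<forall>v\<in>F. \<bar>dist (y u) (y v) - \<bar>u - v\<bar> * dist (y 0) (y 1)\<bar> \<le> \<delta>)"
      using F subset_trans[OF F(2) D(1)] \<open>\<delta> > 0\<close>
      by (intro W2_geodesic_near_geodesic_points[OF \<mu>] borel_compact K) (blast | assumption)+
  qed (use D K in auto)
  then obtain y where y: "\<And>u. u \<in> D \<Longrightarrow> y u \<in> K u"
    "\<And>u v. u \<in> D \<Longrightarrow> v \<in> D \<Longrightarrow> dist (y u) (y v) = \<bar>u - v\<bar> * dist (y 0) (y 1)"
    by blast
  obtain \<gamma> where \<gamma>: "minimal_geodesic dist \<gamma>" "\<And>u. u \<in> D \<Longrightarrow> \<gamma> u = y u"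
    using extend_geodesic_from_dense[OF D(1) dense D(2,3) y(2)] by blast
  have "y u \<in> B u" if "u \<in> D" for u
    using y(1)[OF that] H(1)[OF subsetD[OF D(1) that]] by (auto simp: K_def split: if_splits)
  from this[of 0] this[of 1] have "\<gamma> 0 \<in> A\<^sub>0" "\<gamma> 1 \<in> A\<^sub>1"
    using D \<gamma>(2) by (auto simp: B_def)
  with \<gamma>(1) have "\<gamma> t \<in> intermediate_set A\<^sub>0 A\<^sub>1 t"
    by (auto simp: intermediate_set_def)
  moreover have "\<gamma> t \<in> C"
    using y(1)[of t] \<gamma>(2)[of t] D by (simp add: K_def)
  ultimately show False
    using C(1) E(2) by auto
qed

section \<open>Negative powers and the entropy\<close>

lemma enn_powr_antimono:
  assumes "a < 0" "x \<le> y"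
  shows "enn_powr y a \<le> enn_powr x a"
proof (cases "x = 0 \<or> y = \<infinity>")
  case False
  then have "x \<noteq> \<infinity>" "y \<noteq> 0"
    using assms(2) by (auto simp: top_unique)
  obtain u where u: "x = ennreal u" "u \<ge> 0"
    using \<open>x \<noteq> \<infinity>\<close> by (cases x) auto
  obtain v where v: "y = ennreal v" "v \<ge> 0"
    using False by (cases y) auto
  have "0 < u" "u \<le> v"
    using False u v assms(2) by (auto simp: less_le)
  then have "v powr a \<le> u powr a"
    using assms(1) by (intro powr_mono2') auto
  then show ?thesis
    using False u v \<open>0 < u\<close> \<open>u \<le> v\<close> assms(1) by (auto simp: enn_powr_def intro: ennreal_leI)
qed (use assms in \<open>auto simp: enn_powr_def\<close>)

lemma enn_powr_mono:
  assumes "a > 0" "x \<le> y"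
  shows "enn_powr x a \<le> enn_powr y a"
proof (cases "x = 0 \<or> y = \<infinity>")
  case False
  then have "x \<noteq> \<infinity>" "y \<noteq> 0"
    using assms(2) by (auto simp: top_unique)
  obtain u where u: "x = ennreal u" "u \<ge> 0"
    using \<open>x \<noteq> \<infinity>\<close> by (cases x) auto
  obtain v where v: "y = ennreal v" "v \<ge> 0"
    using False by (cases y) auto
  have "u \<le> v"
    using u v assms(2) by auto
  then have "u powr a \<le> v powr a"
    using assms(1) u by (intro powr_mono2) auto
  then show ?thesis
    using False u v assms(1) by (auto simp: enn_powr_def intro: ennreal_leI)
qed (use assms in \<open>auto simp: enn_powr_def\<close>)

lemma enn_powr_ennreal: "v > 0 \<Longrightarrow> enn_powr (ennreal v) a = ennreal (v powr a)"
  by (auto simp: enn_powr_def)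

lemma borel_measurable_enn_powr[measurable]: "(\<lambda>x. enn_powr x a) \<in> borel_measurable borel"
  unfolding enn_powr_def by measurable

text \<open>
  The limit \<open>\<infinity>\<close> is included: there the power tends to \<open>0\<close>, which covers sets of infinite measure.
\<close>

lemma tendsto_enn_powr_neg:
  assumes "a < 0" and lim: "(f \<longlongrightarrow> l) F" and "l \<noteq> 0"
    and fin: "eventually (\<lambda>k. 0 < f k \<and> f k < \<infinity>) F"
  shows "((\<lambda>k. enn_powr (f k) a) \<longlongrightarrow> enn_powr l a) F"
proof -
  define x where "x k = enn2real (f k)" for k
  have eq: "eventually (\<lambda>k. ennreal (x k powr a) = enn_powr (f k) a) F"
    using fin by eventually_elim (use assms(1) in \<open>auto simp: x_def enn_powr_def\<close>)
  have "((\<lambda>k. ennreal (x k powr a)) \<longlongrightarrow> enn_powr l a) F"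
  proof (cases "l = \<infinity>")
    case True
    have "filterlim x at_top F"
      unfolding filterlim_at_top
    proof
      fix Z :: real
      have "eventually (\<lambda>k. ennreal (max Z 0) < f k) F"
        using lim True by (intro order_tendstoD(1)[of f \<infinity>]) auto
      with fin show "eventually (\<lambda>k. Z \<le> x k) F"
      proof eventually_elim
        case (elim k)
        then have "ennreal (max Z 0) < ennreal (x k)"
          by (auto simp: x_def)
        then have "max Z 0 < x k"
          by (meson ennreal_leI not_le)
        then show ?case by simp
      qed
    qed
    then have "((\<lambda>k. x k powr a) \<longlongrightarrow> 0) F"
      using assms(1) by (intro tendsto_neg_powr) auto
    then have "((\<lambda>k. ennreal (x k powr a)) \<longlongrightarrow> ennreal 0) F"
      by (rule tendsto_ennrealI)
    then show ?thesis
      using True assms(1) by (simp add: enn_powr_def)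
  next
    case False
    then have "(x \<longlongrightarrow> enn2real l) F"
      unfolding x_def using lim by (cases l) (auto intro!: tendsto_enn2real)
    moreover have "enn2real l \<noteq> 0"
      using False assms(3) by (simp add: enn2real_eq_0_iff)
    ultimately have "((\<lambda>k. x k powr a) \<longlongrightarrow> enn2real l powr a) F"
      by (intro tendsto_powr tendsto_const)
    then have "((\<lambda>k. ennreal (x k powr a)) \<longlongrightarrow> ennreal (enn2real l powr a)) F"
      by (rule tendsto_ennrealI)
    then show ?thesis
      using False assms by (simp add: enn_powr_def)
  qed
  then show ?thesis
    by (rule Lim_transform_eventually) (rule eq)
qed

text \<open>
  The graph of \<open>x \<mapsto> x powr p\<close> lies above its tangent at \<open>a\<close>; this is Young's inequality.
\<close>

lemma powr_tangent_below:
  fixes a x p :: real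
  assumes "p > 1" "a > 0" "x \<ge> 0"
  shows "p * a powr (p - 1) * x \<le> x powr p + (p - 1) * a powr p"
proof -
  define q where "q = p / (p - 1)"
  have q: "q > 1" "1 / p + 1 / q = 1"
    using assms(1) by (auto simp: q_def field_simps)
  have "x * a powr (p - 1) \<le> x powr p / p + (a powr (p - 1)) powr q / q"
    using assms q by (intro Youngs_inequality) auto
  also have "(a powr (p - 1)) powr q = a powr p"
    using assms(1) by (simp add: powr_powr q_def)
  also have "x powr p / p + a powr p / q = (x powr p + (p - 1) * a powr p) / p"
    using assms(1) by (simp add: q_def field_simps)
  finally show ?thesis
    using assms(1) by (simp add: field_simps)
qed

text \<open>
  Among densities with mass \<open>1\<close> on \<open>E\<close> the entropy is smallest for the uniform one. Integrating the
  tangent inequality at the value \<open>1 / m(E)\<close> of the uniform density gives this form of Jensen's inequality.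
\<close>

lemma measure_powr_le_renyi_integral:
  assumes "N < 0" and [measurable]: "\<rho> \<in> borel_measurable m" and E[measurable]: "E \<in> sets m"
    and mass: "(\<integral>\<^sup>+x\<in>E. \<rho> x \<partial>m) = 1"
  shows "enn_powr (emeasure m E) (1 / N) \<le> (\<integral>\<^sup>+x. enn_powr (\<rho> x) ((N - 1) / N) \<partial>m)"
proof -
  define p where "p = (N - 1) / N"
  have p: "p > 1" "p - 1 = - 1 / N"
    using assms(1) by (auto simp: p_def field_simps)
  define I where "I = (\<integral>\<^sup>+x\<in>E. enn_powr (\<rho> x) p \<partial>m)"
  have "I \<le> (\<integral>\<^sup>+x. enn_powr (\<rho> x) p \<partial>m)"
    unfolding I_def by (intro nn_integral_mono) (auto simp: indicator_def)
  moreover have "enn_powr (emeasure m E) (1 / N) \<le> I"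
  proof (cases "emeasure m E = \<infinity>")
    case True
    then show ?thesis
      using assms(1) by (simp add: enn_powr_def)
  next
    case False
    have "emeasure m E \<noteq> 0"
    proof
      assume "emeasure m E = 0"
      then have "AE x in m. x \<notin> E"
        using E by (intro AE_not_in) (auto simp: null_sets_def)
      then have "(\<integral>\<^sup>+x\<in>E. \<rho> x \<partial>m) = (\<integral>\<^sup>+x. 0 \<partial>m)"
        by (intro nn_integral_cong_AE) auto
      with mass show False by simp
    qed
    with False obtain v where v: "emeasure m E = ennreal v" "v > 0"
      by (cases "emeasure m E") (auto simp: less_le)
    \<comment> \<open>The tangent point is the value of the uniform density on \<open>E\<close>.\<close>
    define a where "a = 1 / v"
    have "a > 0" using v by (simp add: a_def)
    define c d where "c = p * a powr (p - 1)" and "d = (p - 1) * a powr p"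
    have "c \<ge> 0" "d \<ge> 0" using p(1) by (auto simp: c_def d_def)
    have tangent: "ennreal c * \<rho> x \<le> enn_powr (\<rho> x) p + ennreal d" for x
    proof (cases "\<rho> x")
      case (real u)
      have "c * u \<le> u powr p + d"
        unfolding c_def d_def using p \<open>a > 0\<close> real(1) by (intro powr_tangent_below) auto
      moreover have "enn_powr (\<rho> x) p = ennreal (u powr p)"
        using p real by (auto simp: enn_powr_def)
      ultimately show ?thesis
        using real \<open>c \<ge> 0\<close> \<open>d \<ge> 0\<close> by (simp flip: ennreal_plus ennreal_mult')
    next
      case top
      then show ?thesis
        using p by (simp add: enn_powr_def)
    qed
    have "ennreal c = ennreal c * (\<integral>\<^sup>+x\<in>E. \<rho> x \<partial>m)"
      by (simp add: mass)
    also have "\<dots> = (\<integral>\<^sup>+x. ennreal c * \<rho> x * indicator E x \<partial>m)"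
      by (simp add: nn_integral_cmult mult.assoc)
    also have "\<dots> \<le> (\<integral>\<^sup>+x. enn_powr (\<rho> x) p * indicator E x + ennreal d * indicator E x \<partial>m)"
      using tangent by (intro nn_integral_mono) (auto simp: indicator_def)
    also have "\<dots> = I + ennreal d * ennreal v"
      by (simp add: nn_integral_add nn_integral_cmult I_def v)
    also have "ennreal d * ennreal v = ennreal ((p - 1) * a powr (p - 1))"
    proof -
      have "a powr p = a powr (p - 1) * a"
        using \<open>a > 0\<close> by (simp add: powr_diff)
      then have "d * v = (p - 1) * a powr (p - 1)"
        using v by (simp add: d_def a_def)
      then show ?thesis
        using \<open>d \<ge> 0\<close> by (simp flip: ennreal_mult')
    qed
    finally have *: "ennreal c \<le> I + ennreal ((p - 1) * a powr (p - 1))" .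
    have "ennreal (a powr (p - 1)) \<le> I"
    proof (cases I)
      case (real u)
      have "0 \<le> (p - 1) * a powr (p - 1)"
        using p(1) by simp
      then have "c \<le> u + (p - 1) * a powr (p - 1)"
        using * real by (simp flip: ennreal_plus)
      then have "a powr (p - 1) \<le> u"
        by (simp add: c_def algebra_simps)
      then show ?thesis
        using real by (simp add: ennreal_leI)
    qed simp
    moreover have "a powr (p - 1) = v powr (1 / N)"
      using v by (simp add: p(2) a_def powr_divide powr_minus_divide)
    ultimately show ?thesis
      using v by (simp add: enn_powr_ennreal)
  qed
  ultimately show ?thesis
    by (simp add: p_def)
qed

section \<open>Boundedness of the distortion coefficients\<close>

text \<open>
  In positive curvature \<open>sin\<close> is increasing up to \<open>pi / 2\<close>, and beyond that the denominator stays away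
  from \<open>0\<close> because \<open>d\<close> is below the threshold; in nonpositive curvature the quotient is at most \<open>1\<close>.
\<close>

lemma sigma_coeff_bounded:
  assumes "t \<in> {0..1}" "\<kappa> > 0 \<Longrightarrow> d < pi / sqrt \<kappa>"
  shows "\<exists>B\<ge>0. \<forall>\<theta>. 0 \<le> \<theta> \<and> (\<kappa> > 0 \<longrightarrow> \<theta> \<le> d) \<longrightarrow> sigma_coeff \<kappa> t \<theta> \<le> ennreal B"
proof (cases "\<kappa> > 0")
  case True
  define s where "s = sqrt \<kappa>"
  define a where "a = s * d"
  have "s > 0" using True by (simp add: s_def)
  have "a < pi"
    using assms(2)[OF True] \<open>s > 0\<close> by (simp add: a_def s_def field_simps)
  define B where "B = max 1 (1 / sin a)"
  have "sigma_coeff \<kappa> t \<theta> \<le> ennreal B" if \<theta>: "0 \<le> \<theta>" "\<theta> \<le> d" for \<theta>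
  proof (cases "\<theta> = 0")
    case False
    define \<alpha> where "\<alpha> = s * \<theta>"
    have \<alpha>: "0 < \<alpha>" "\<alpha> \<le> a"
      using False \<theta> \<open>s > 0\<close> by (auto simp: \<alpha>_def a_def)
    have "sin \<alpha> > 0"
      using \<alpha> \<open>a < pi\<close> by (intro sin_gt_zero) auto
    have "t * \<alpha> \<le> 1 * \<alpha>"
      using assms(1) \<alpha> by (intro mult_right_mono) auto
    then have t\<alpha>: "0 \<le> t * \<alpha>" "t * \<alpha> \<le> \<alpha>"
      using assms(1) \<alpha> by auto
    have "sin (t * \<alpha>) / sin \<alpha> \<le> B"
    proof (cases "\<alpha> \<le> pi / 2")
      case True
      then have "sin (t * \<alpha>) \<le> sin \<alpha>"
        using t\<alpha> by (intro sin_monotone_2pi_le) auto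
      then have "sin (t * \<alpha>) / sin \<alpha> \<le> 1"
        using \<open>sin \<alpha> > 0\<close> by simp
      then show ?thesis by (simp add: B_def)
    next
      case False
      have "sin (pi - a) \<le> sin (pi - \<alpha>)"
        using False \<alpha> \<open>a < pi\<close> by (intro sin_monotone_2pi_le) auto
      then have "sin a \<le> sin \<alpha>" by simp
      moreover have "sin a > 0"
        using \<alpha> \<open>a < pi\<close> by (intro sin_gt_zero) auto
      ultimately have "sin (t * \<alpha>) / sin \<alpha> \<le> 1 / sin a"
        using \<open>sin \<alpha> > 0\<close> by (intro frac_le) auto
      then show ?thesis by (simp add: B_def)
    qed
    moreover have "gen_sin \<kappa> (t * \<theta>) / gen_sin \<kappa> \<theta> = sin (t * \<alpha>) / sin \<alpha>"
      using True \<open>s > 0\<close> by (simp add: gen_sin_def \<alpha>_def s_def[symmetric] mult.left_commute)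
    moreover have "\<not> pi / sqrt \<kappa> \<le> \<theta>"
      using assms(2)[OF True] \<theta> by simp
    ultimately show ?thesis
      using False by (auto simp: sigma_coeff_def intro: ennreal_leI)
  next
    case True
    have "0 < pi / sqrt \<kappa>"
      using \<open>\<kappa> > 0\<close> by simp
    then have "sigma_coeff \<kappa> t \<theta> = ennreal t"
      using True by (auto simp: sigma_coeff_def)
    also have "\<dots> \<le> ennreal B"
      using assms(1) by (intro ennreal_leI) (auto simp: B_def)
    finally show ?thesis .
  qed
  then show ?thesis
    using True by (intro exI[of _ B]) (auto simp: B_def)
next
  case False
  have "sigma_coeff \<kappa> t \<theta> \<le> ennreal 1" if "0 \<le> \<theta>" for \<theta>
  proof (cases "\<theta> = 0")
    case nonzero: False
    have "t * \<theta> \<le> 1 * \<theta>"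
      using assms(1) that by (intro mult_right_mono) auto
    then have t\<theta>: "0 \<le> t * \<theta>" "t * \<theta> \<le> \<theta>"
      using assms(1) that by auto
    have "gen_sin \<kappa> (t * \<theta>) / gen_sin \<kappa> \<theta> \<le> 1"
    proof (cases "\<kappa> = 0")
      case True
      then show ?thesis
        using nonzero assms(1) by (simp add: gen_sin_def)
    next
      case \<kappa>: False
      define s where "s = sqrt (- \<kappa>)"
      have "s > 0" using False \<kappa> by (simp add: s_def)
      have "sinh (s * \<theta>) > 0"
        using \<open>s > 0\<close> nonzero that by simp
      moreover have "sinh (s * (t * \<theta>)) \<le> sinh (s * \<theta>)"
        using \<open>s > 0\<close> t\<theta> by simp
      ultimately have "sinh (s * (t * \<theta>)) / sinh (s * \<theta>) \<le> 1" by simp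
      then show ?thesis
        using False \<kappa> \<open>s > 0\<close> by (simp add: gen_sin_def s_def[symmetric])
    qed
    then show ?thesis
      using False nonzero by (auto simp: sigma_coeff_def intro: ennreal_leI)
  qed (use assms(1) False in \<open>auto simp: sigma_coeff_def\<close>)
  then show ?thesis
    using False by (intro exI[of _ 1]) auto
qed

lemma tau_coeff_bounded:
  assumes "t \<in> {0..1}" "N < 0" "K < 0 \<Longrightarrow> d < pi * sqrt ((N - 1) / K)"
  shows "\<exists>B<\<infinity>. \<forall>\<theta>. 0 \<le> \<theta> \<and> (K < 0 \<longrightarrow> \<theta> \<le> d) \<longrightarrow> tau_coeff K N t \<theta> \<le> B"
proof -
  define \<kappa> where "\<kappa> = K / (N - 1)"
  have \<kappa>: "\<kappa> > 0 \<longleftrightarrow> K < 0"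
    using assms(2) by (auto simp: \<kappa>_def divide_simps)
  have threshold: "pi * sqrt ((N - 1) / K) = pi / sqrt \<kappa>"
    by (simp add: \<kappa>_def real_sqrt_divide)
  obtain B where B: "B \<ge> 0"
    "\<And>\<theta>. 0 \<le> \<theta> \<Longrightarrow> (K < 0 \<longrightarrow> \<theta> \<le> d) \<Longrightarrow> sigma_coeff \<kappa> t \<theta> \<le> ennreal B"
    using sigma_coeff_bounded[OF assms(1), of \<kappa> d] assms(3) \<kappa> threshold by auto
  define C where "C = ennreal (t powr (1 / N)) * enn_powr (ennreal B) ((N - 1) / N)"
  have p: "(N - 1) / N > 0"
    using assms(2) by (simp add: divide_neg_neg)
  have "C < \<infinity>"
    using p by (auto simp: C_def enn_powr_def ennreal_mult_less_top)
  moreover have "tau_coeff K N t \<theta> \<le> C" if "0 \<le> \<theta>" "K < 0 \<longrightarrow> \<theta> \<le> d" for \<theta>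
  proof -
    have "\<not> (K < 0 \<and> pi * sqrt ((N - 1) / K) \<le> \<theta>)"
      using assms(3) that(2) by auto
    then have "tau_coeff K N t \<theta> \<le>
        ennreal (t powr (1 / N)) * enn_powr (sigma_coeff \<kappa> t \<theta>) ((N - 1) / N)"
      by (auto simp: tau_coeff_def \<kappa>_def)
    also have "\<dots> \<le> C"
      unfolding C_def using that by (intro mult_left_mono enn_powr_mono p B(2)) auto
    finally show ?thesis .
  qed
  ultimately show ?thesis by blast
qed

section \<open>The inequality for measures of intermediate sets\<close>

lemma uniform_measure_in_P2:
  fixes m :: "'a::polish_space measure"
  assumes sets: "sets m = sets borel" and A: "A \<in> sets m" "bounded A"
    and pos: "emeasure m A \<noteq> 0" and fin: "emeasure m A \<noteq> \<infinity>"
  shows "uniform_measure m A \<in> P2"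
proof -
  have "A \<noteq> {}" using pos by auto
  then obtain x0 where "x0 \<in> A" by blast
  with A(2) obtain r where r: "\<And>x. x \<in> A \<Longrightarrow> dist x0 x \<le> r"
    unfolding bounded_any_center[of A x0] by blast
  interpret U: prob_space "uniform_measure m A"
    by (rule prob_space_uniform_measure[OF pos fin])
  have "(\<integral>\<^sup>+x. ennreal ((dist x0 x)\<^sup>2) \<partial>uniform_measure m A) \<le> (\<integral>\<^sup>+x. ennreal (r\<^sup>2) \<partial>uniform_measure m A)"
    using A(1) r
    by (intro nn_integral_mono_AE AE_uniform_measureI) (auto intro!: ennreal_leI power_mono)
  also have "\<dots> < \<infinity>"
    using U.emeasure_space_1 by simp
  finally show ?thesis
    using U.prob_space_axioms sets by (auto simp: P2_def)
qed

text \<open>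
  The curvature-dimension condition for the uniform distributions on \<open>A\<^sub>0\<close> and \<open>A\<^sub>1\<close>. The coupling
  lives on \<open>A\<^sub>0 \<times> A\<^sub>1\<close>, so the distortion coefficients may be replaced by their bounds there.
\<close>

lemma CD_with_bounded_inequality:
  fixes m :: "'a::polish_space measure"
  assumes sets: "sets m = sets borel" and "sigma_finite_measure m" and "N < 0"
    and CD: "CD_with \<beta> N m"
    and A0: "A\<^sub>0 \<in> sets m" "bounded A\<^sub>0" "emeasure m A\<^sub>0 \<noteq> 0" "emeasure m A\<^sub>0 \<noteq> \<infinity>"
    and A1: "A\<^sub>1 \<in> sets m" "bounded A\<^sub>1" "emeasure m A\<^sub>1 \<noteq> 0" "emeasure m A\<^sub>1 \<noteq> \<infinity>"
    and t: "t \<in> {0..1}"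
    and S0: "\<And>x y. x \<in> A\<^sub>0 \<Longrightarrow> y \<in> A\<^sub>1 \<Longrightarrow> \<beta> N (1 - t) (dist x y) \<le> S\<^sub>0"
    and S1: "\<And>x y. x \<in> A\<^sub>0 \<Longrightarrow> y \<in> A\<^sub>1 \<Longrightarrow> \<beta> N t (dist x y) \<le> S\<^sub>1"
  shows "enn_powr (outer_measure_of m (intermediate_set A\<^sub>0 A\<^sub>1 t)) (1 / N)
    \<le> S\<^sub>0 * enn_powr (emeasure m A\<^sub>0) (1 / N) + S\<^sub>1 * enn_powr (emeasure m A\<^sub>1) (1 / N)"
    (is "_ \<le> ?rhs")
proof -
  interpret sigma_finite_measure m by fact
  define \<rho> where "\<rho> A x = indicator A x / emeasure m A" for A and x :: 'a
  have density: "density m (\<rho> A) = uniform_measure m A" for A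
    by (simp add: uniform_measure_def \<rho>_def[abs_def])
  have \<rho>_meas: "\<rho> A \<in> borel_measurable m" if [measurable]: "A \<in> sets m" for A
    unfolding \<rho>_def by measurable
  have P2: "density m (\<rho> A\<^sub>0) \<in> P2" "density m (\<rho> A\<^sub>1) \<in> P2"
    unfolding density using A0 A1 by (auto intro!: uniform_measure_in_P2 sets)
  obtain \<mu> \<pi> where \<mu>: "W2_geodesic \<mu>" "\<mu> 0 = density m (\<rho> A\<^sub>0)" "\<mu> 1 = density m (\<rho> A\<^sub>1)"
    and \<pi>: "optimal_coupling \<pi> (density m (\<rho> A\<^sub>0)) (density m (\<rho> A\<^sub>1))"
    and entropy: "\<forall>t\<in>{0..1}. \<forall>N'\<in>{N..<0}. renyi_entropy N' m (\<mu> t) \<le>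
        (\<integral>\<^sup>+(x, y). \<beta> N' (1 - t) (dist x y) * enn_powr (\<rho> A\<^sub>0 x) (- 1 / N')
                  + \<beta> N' t (dist x y) * enn_powr (\<rho> A\<^sub>1 y) (- 1 / N') \<partial>\<pi>)"
    using CD[unfolded CD_with_def, rule_format, OF \<rho>_meas[OF A0(1)] \<rho>_meas[OF A1(1)] P2] by blast
  have \<pi>_sets: "sets \<pi> = sets borel" "distr \<pi> borel fst = uniform_measure m A\<^sub>0"
    "distr \<pi> borel snd = uniform_measure m A\<^sub>1"
    using \<pi> by (auto simp: optimal_coupling_def couplings_def density)
  have [measurable]: "fst \<in> measurable \<pi> borel" "snd \<in> measurable \<pi> borel"
    using \<pi>_sets(1) by (auto cong: measurable_cong_sets simp: borel_prod[symmetric])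
  have "prob_space \<pi>"
    using prob_space_uniform_measure[OF A0(3,4)] \<pi>_sets(2)
    by (intro prob_space_distrD[of fst \<pi> borel]) auto
  then interpret \<pi>: prob_space \<pi> .
  have "AE x in distr \<pi> borel fst. x \<in> A\<^sub>0" "AE x in distr \<pi> borel snd. x \<in> A\<^sub>1"
    unfolding \<pi>_sets using A0(1) A1(1) by (auto intro!: AE_uniform_measureI)
  then have AE_A: "AE z in \<pi>. fst z \<in> A\<^sub>0" "AE z in \<pi>. snd z \<in> A\<^sub>1"
    using A0(1) A1(1) sets by (auto simp: AE_distr_iff)
  have \<rho>_powr: "enn_powr (\<rho> A x) (- 1 / N) = enn_powr (emeasure m A) (1 / N)"
    if "x \<in> A" and pos: "emeasure m A \<noteq> 0" and fin: "emeasure m A \<noteq> \<infinity>" for A x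
  proof -
    obtain v where v: "emeasure m A = ennreal v" "v > 0"
      using pos fin by (cases "emeasure m A") (auto simp: less_le)
    have "\<rho> A x = ennreal (1 / v)"
      using that(1) v by (simp add: \<rho>_def divide_ennreal flip: ennreal_1)
    moreover have "(1 / v) powr (- 1 / N) = v powr (1 / N)"
      using v by (simp add: powr_divide powr_minus_divide)
    ultimately show ?thesis
      using v by (simp add: enn_powr_ennreal)
  qed
  have "renyi_entropy N m (\<mu> t) \<le>
      (\<integral>\<^sup>+(x, y). \<beta> N (1 - t) (dist x y) * enn_powr (\<rho> A\<^sub>0 x) (- 1 / N)
                + \<beta> N t (dist x y) * enn_powr (\<rho> A\<^sub>1 y) (- 1 / N) \<partial>\<pi>)"
    using entropy t \<open>N < 0\<close> by auto
  also have "\<dots> \<le> (\<integral>\<^sup>+z. ?rhs \<partial>\<pi>)"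
  proof (rule nn_integral_mono_AE)
    show "AE z in \<pi>. (case z of (x, y) \<Rightarrow> \<beta> N (1 - t) (dist x y) * enn_powr (\<rho> A\<^sub>0 x) (- 1 / N)
                + \<beta> N t (dist x y) * enn_powr (\<rho> A\<^sub>1 y) (- 1 / N)) \<le> ?rhs"
      using AE_A
    proof eventually_elim
      case (elim z)
      show ?case
        unfolding case_prod_unfold \<rho>_powr[OF elim(1) A0(3,4)] \<rho>_powr[OF elim(2) A1(3,4)]
        by (intro add_mono mult_right_mono S0 S1 elim) auto
    qed
  qed
  also have "\<dots> = ?rhs"
    by (simp add: \<pi>.emeasure_space_1)
  finally have entropy_le: "renyi_entropy N m (\<mu> t) \<le> ?rhs" .
  show ?thesis
  proof (cases "absolutely_continuous m (\<mu> t)")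
    case False
    then have "?rhs = \<infinity>"
      using entropy_le by (simp add: renyi_entropy_def top_unique)
    then show ?thesis by (simp only: infinity_ennreal_def top_greatest)
  next
    case True
    have \<mu>t: "sets (\<mu> t) = sets m" "prob_space (\<mu> t)"
      using \<mu>(1) t sets by (auto simp: W2_geodesic_def P2_def)
    have sp: "space m = UNIV"
      using sets_eq_imp_space_eq[OF sets] by simp
    obtain E where E: "E \<in> sets m" "intermediate_set A\<^sub>0 A\<^sub>1 t \<subseteq> E"
      "outer_measure_of m (intermediate_set A\<^sub>0 A\<^sub>1 t) = emeasure m E"
      using outer_measure_of_attain[of "intermediate_set A\<^sub>0 A\<^sub>1 t" m] sp by auto
    have "measure (\<mu> t) E = 1"
    proof (rule W2_geodesic_concentrated_on_intermediate_set[OF \<mu>(1) t])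
      show "measure (\<mu> 0) A\<^sub>0 = 1" "measure (\<mu> 1) A\<^sub>1 = 1"
        unfolding \<mu> density
        using emeasure_uniform_measure_1 A0(3,4) A1(3,4) by (auto simp: measure_def)
    qed (use A0(1) A1(1) E sets in auto)
    then have "emeasure (\<mu> t) E = 1"
      by (simp add: finite_measure.emeasure_eq_measure prob_space.finite_measure[OF \<mu>t(2)])
    also have "\<mu> t = density m (RN_deriv m (\<mu> t))"
      using density_RN_deriv[OF True \<mu>t(1)] by simp
    also have "emeasure \<dots> E = (\<integral>\<^sup>+x\<in>E. RN_deriv m (\<mu> t) x \<partial>m)"
      using E(1) by (intro emeasure_density) auto
    finally have "enn_powr (emeasure m E) (1 / N) \<le> renyi_entropy N m (\<mu> t)"
      using True \<open>N < 0\<close> E(1) by (simp add: renyi_entropy_def measure_powr_le_renyi_integral)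
    with entropy_le E(3) show ?thesis by simp
  qed
qed

lemma intermediate_set_mono:
  "A \<subseteq> A' \<Longrightarrow> B \<subseteq> B' \<Longrightarrow> intermediate_set A B t \<subseteq> intermediate_set A' B' t"
  by (auto simp: intermediate_set_def)

text \<open>
  Exhaustion by bounded sets of finite measure. Shrinking the sets shrinks the set of intermediate
  points, which increases the left-hand side, since the exponent is negative.
\<close>

lemma CD_with_inequality:
  fixes m :: "'a::polish_space measure"
  assumes sets: "sets m = sets borel" and "sigma_finite_measure m" and "N < 0"
    and CD: "CD_with \<beta> N m"
    and A0: "A\<^sub>0 \<in> sets m" "emeasure m A\<^sub>0 \<noteq> 0" and A1: "A\<^sub>1 \<in> sets m" "emeasure m A\<^sub>1 \<noteq> 0"
    and t: "t \<in> {0..1}"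
    and S0: "\<And>x y. x \<in> A\<^sub>0 \<Longrightarrow> y \<in> A\<^sub>1 \<Longrightarrow> \<beta> N (1 - t) (dist x y) \<le> S\<^sub>0" "S\<^sub>0 < \<infinity>"
    and S1: "\<And>x y. x \<in> A\<^sub>0 \<Longrightarrow> y \<in> A\<^sub>1 \<Longrightarrow> \<beta> N t (dist x y) \<le> S\<^sub>1" "S\<^sub>1 < \<infinity>"
  shows "enn_powr (outer_measure_of m (intermediate_set A\<^sub>0 A\<^sub>1 t)) (1 / N)
    \<le> S\<^sub>0 * enn_powr (emeasure m A\<^sub>0) (1 / N) + S\<^sub>1 * enn_powr (emeasure m A\<^sub>1) (1 / N)"
proof -
  interpret sigma_finite_measure m by fact
  have sp: "space m = UNIV"
    using sets_eq_imp_space_eq[OF sets] by simp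
  obtain H :: "nat \<Rightarrow> 'a set" where H: "range H \<subseteq> sets m" "(\<Union>k. H k) = UNIV"
    "\<And>k. emeasure m (H k) \<noteq> \<infinity>" "incseq H"
    using sigma_finite_incseq sp by metis
  obtain x0 :: 'a where True by blast
  define part where "part A k = A \<inter> (H k \<inter> cball x0 (real k))" for A k
  have part_sets: "part A k \<in> sets m" if "A \<in> sets m" for A k
    using that H(1) sets by (auto simp: part_def)
  have part_bounded: "bounded (part A k)" for A k
    by (rule bounded_subset[OF bounded_cball[of x0 "real k"]]) (auto simp: part_def)
  have part_finite: "emeasure m (part A k) < \<infinity>" for A k
  proof -
    have "emeasure m (part A k) \<le> emeasure m (H k)"
      using H(1) by (intro emeasure_mono) (auto simp: part_def)
    also have "\<dots> < \<infinity>"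
      using H(3)[of k] by (simp add: less_top)
    finally show ?thesis .
  qed
  have part_inc: "incseq (part A)" for A
    using H(4) by (fastforce simp: incseq_def part_def)
  have part_Union: "(\<Union>k. part A k) = A" for A
  proof -
    have "\<exists>k. x \<in> H k \<inter> cball x0 (real k)" for x
    proof -
      obtain i where "x \<in> H i" using H(2) by auto
      moreover obtain j where "dist x0 x \<le> real j" using real_arch_simple by blast
      ultimately show ?thesis
        using H(4) by (intro exI[of _ "max i j"]) (auto simp: incseq_def subset_iff max_def)
    qed
    then show ?thesis by (auto simp: part_def)
  qed
  have part_lim: "(\<lambda>k. emeasure m (part A k)) \<longlonglongrightarrow> emeasure m A" if "A \<in> sets m" for A
    using Lim_emeasure_incseq[OF _ part_inc, of A m] part_sets[OF that] by (auto simp: part_Union)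
  have part_pos: "eventually (\<lambda>k. 0 < emeasure m (part A k) \<and> emeasure m (part A k) < \<infinity>) sequentially"
    if "A \<in> sets m" "emeasure m A \<noteq> 0" for A
    using order_tendstoD(1)[OF part_lim[OF that(1)], of 0] that(2) part_finite
    by (auto simp: zero_less_iff_neq_zero)
  have powr_lim: "(\<lambda>k. enn_powr (emeasure m (part A k)) (1 / N)) \<longlonglongrightarrow> enn_powr (emeasure m A) (1 / N)"
    if "A \<in> sets m" "emeasure m A \<noteq> 0" for A
    using \<open>N < 0\<close> that part_lim part_pos by (intro tendsto_enn_powr_neg) auto
  have "((\<lambda>k. S\<^sub>0 * enn_powr (emeasure m (part A\<^sub>0 k)) (1 / N) + S\<^sub>1 * enn_powr (emeasure m (part A\<^sub>1 k)) (1 / N))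
      \<longlonglongrightarrow> S\<^sub>0 * enn_powr (emeasure m A\<^sub>0) (1 / N) + S\<^sub>1 * enn_powr (emeasure m A\<^sub>1) (1 / N))"
    using S0(2) S1(2) A0 A1 by (intro tendsto_add ennreal_tendsto_cmult powr_lim) auto
  moreover have "eventually (\<lambda>k. enn_powr (outer_measure_of m (intermediate_set A\<^sub>0 A\<^sub>1 t)) (1 / N)
      \<le> S\<^sub>0 * enn_powr (emeasure m (part A\<^sub>0 k)) (1 / N)
        + S\<^sub>1 * enn_powr (emeasure m (part A\<^sub>1 k)) (1 / N)) sequentially"
    using part_pos[OF A0] part_pos[OF A1]
  proof eventually_elim
    case (elim k)
    have sub: "part A k \<subseteq> A" for A
      by (auto simp: part_def)
    have "enn_powr (outer_measure_of m (intermediate_set A\<^sub>0 A\<^sub>1 t)) (1 / N)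
        \<le> enn_powr (outer_measure_of m (intermediate_set (part A\<^sub>0 k) (part A\<^sub>1 k) t)) (1 / N)"
      using \<open>N < 0\<close> by (intro enn_powr_antimono outer_measure_of_mono intermediate_set_mono sub) auto
    also have "\<dots> \<le> S\<^sub>0 * enn_powr (emeasure m (part A\<^sub>0 k)) (1 / N)
        + S\<^sub>1 * enn_powr (emeasure m (part A\<^sub>1 k)) (1 / N)"
      using elim A0(1) A1(1)
      by (intro CD_with_bounded_inequality[OF assms(1-4)] part_sets part_bounded t
          S0(1)[OF subsetD[OF sub] subsetD[OF sub]] S1(1)[OF subsetD[OF sub] subsetD[OF sub]]) auto
    finally show ?case .
  qed
  ultimately show ?thesis
    by (intro tendsto_lowerbound) auto
qed

theorem theorem4p8:
  fixes m :: "'a::polish_space measure" and K N :: real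
  assumes "sets m = sets borel"
    and "sigma_finite_measure m"
    and "N < 0"
  shows
    "(CD K N m \<longrightarrow>
        (\<forall>A\<^sub>0\<in>sets m. \<forall>A\<^sub>1\<in>sets m.
           (K < 0 \<longrightarrow> bounded (A\<^sub>0 \<union> A\<^sub>1) \<and> diameter (A\<^sub>0 \<union> A\<^sub>1) < pi * sqrt ((N - 1) / K)) \<longrightarrow>
           (\<forall>t\<in>{0..1}.
              enn_powr (outer_measure_of m (intermediate_set A\<^sub>0 A\<^sub>1 t)) (1 / N) \<le>
                (if emeasure m A\<^sub>0 = 0 \<or> emeasure m A\<^sub>1 = 0 then \<infinity>
                 else (SUP (x, y)\<in>A\<^sub>0 \<times> A\<^sub>1. tau_coeff K N (1 - t) (dist x y))
                        * enn_powr (emeasure m A\<^sub>0) (1 / N)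
                    + (SUP (x, y)\<in>A\<^sub>0 \<times> A\<^sub>1. tau_coeff K N t (dist x y))
                        * enn_powr (emeasure m A\<^sub>1) (1 / N)))))
     \<and> (CD_star K N m \<longrightarrow>
        (\<forall>A\<^sub>0\<in>sets m. \<forall>A\<^sub>1\<in>sets m.
           (K < 0 \<longrightarrow> bounded (A\<^sub>0 \<union> A\<^sub>1) \<and> diameter (A\<^sub>0 \<union> A\<^sub>1) < pi * sqrt (N / K)) \<longrightarrow>
           (\<forall>t\<in>{0..1}.
              enn_powr (outer_measure_of m (intermediate_set A\<^sub>0 A\<^sub>1 t)) (1 / N) \<le>
                (if emeasure m A\<^sub>0 = 0 \<or> emeasure m A\<^sub>1 = 0 then \<infinity>
                 else (SUP (x, y)\<in>A\<^sub>0 \<times> A\<^sub>1. sigma_coeff (K / N) (1 - t) (dist x y))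
                        * enn_powr (emeasure m A\<^sub>0) (1 / N)
                    + (SUP (x, y)\<in>A\<^sub>0 \<times> A\<^sub>1. sigma_coeff (K / N) t (dist x y))
                        * enn_powr (emeasure m A\<^sub>1) (1 / N)))))"
proof (intro conjI impI ballI)
  fix A\<^sub>0 A\<^sub>1 and t :: real
  assume CD: "CD K N m" and A: "A\<^sub>0 \<in> sets m" "A\<^sub>1 \<in> sets m" and t: "t \<in> {0..1}"
    and small: "K < 0 \<longrightarrow> bounded (A\<^sub>0 \<union> A\<^sub>1) \<and> diameter (A\<^sub>0 \<union> A\<^sub>1) < pi * sqrt ((N - 1) / K)"
  have dist_le: "dist x y \<le> diameter (A\<^sub>0 \<union> A\<^sub>1)" if "K < 0" "x \<in> A\<^sub>0" "y \<in> A\<^sub>1" for x y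
    using that small by (intro diameter_bounded_bound) auto
  have finite_SUP: "(SUP (x, y)\<in>A\<^sub>0 \<times> A\<^sub>1. tau_coeff K N u (dist x y)) < \<infinity>" if u: "u \<in> {0..1}" for u
  proof -
    obtain B where "B < \<infinity>" and B: "\<And>\<theta>. 0 \<le> \<theta> \<Longrightarrow> (K < 0 \<longrightarrow> \<theta> \<le> diameter (A\<^sub>0 \<union> A\<^sub>1)) \<Longrightarrow> tau_coeff K N u \<theta> \<le> B"
      using tau_coeff_bounded[OF u assms(3), of K "diameter (A\<^sub>0 \<union> A\<^sub>1)"] small by auto
    have "(SUP (x, y)\<in>A\<^sub>0 \<times> A\<^sub>1. tau_coeff K N u (dist x y)) \<le> B"
      using dist_le by (intro SUP_least) (auto intro!: B)
    then show ?thesis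
      using \<open>B < \<infinity>\<close> by (rule order_le_less_trans)
  qed
  have le_SUP: "tau_coeff K N u (dist x y) \<le> (SUP (x, y)\<in>A\<^sub>0 \<times> A\<^sub>1. tau_coeff K N u (dist x y))"
    if "x \<in> A\<^sub>0" "y \<in> A\<^sub>1" for u x y
    using that by (intro SUP_upper2[of "(x, y)"]) auto
  show "enn_powr (outer_measure_of m (intermediate_set A\<^sub>0 A\<^sub>1 t)) (1 / N) \<le>
      (if emeasure m A\<^sub>0 = 0 \<or> emeasure m A\<^sub>1 = 0 then \<infinity>
       else (SUP (x, y)\<in>A\<^sub>0 \<times> A\<^sub>1. tau_coeff K N (1 - t) (dist x y)) * enn_powr (emeasure m A\<^sub>0) (1 / N)
          + (SUP (x, y)\<in>A\<^sub>0 \<times> A\<^sub>1. tau_coeff K N t (dist x y)) * enn_powr (emeasure m A\<^sub>1) (1 / N))"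
    using CD_with_inequality[OF assms CD[unfolded CD_def] A(1) _ A(2) _ t le_SUP finite_SUP le_SUP finite_SUP] t
    by auto
next
  fix A\<^sub>0 A\<^sub>1 and t :: real
  assume CD: "CD_star K N m" and A: "A\<^sub>0 \<in> sets m" "A\<^sub>1 \<in> sets m" and t: "t \<in> {0..1}"
    and small: "K < 0 \<longrightarrow> bounded (A\<^sub>0 \<union> A\<^sub>1) \<and> diameter (A\<^sub>0 \<union> A\<^sub>1) < pi * sqrt (N / K)"
  have \<kappa>: "K / N > 0 \<longleftrightarrow> K < 0"
    using assms(3) by (auto simp: divide_simps)
  have threshold: "pi * sqrt (N / K) = pi / sqrt (K / N)"
    by (simp add: real_sqrt_divide)
  have dist_le: "dist x y \<le> diameter (A\<^sub>0 \<union> A\<^sub>1)" if "K < 0" "x \<in> A\<^sub>0" "y \<in> A\<^sub>1" for x y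
    using that small by (intro diameter_bounded_bound) auto
  have finite_SUP: "(SUP (x, y)\<in>A\<^sub>0 \<times> A\<^sub>1. sigma_coeff (K / N) u (dist x y)) < \<infinity>" if u: "u \<in> {0..1}" for u
  proof -
    obtain B where B: "\<And>\<theta>. 0 \<le> \<theta> \<Longrightarrow> (K < 0 \<longrightarrow> \<theta> \<le> diameter (A\<^sub>0 \<union> A\<^sub>1)) \<Longrightarrow> sigma_coeff (K / N) u \<theta> \<le> ennreal B"
      using sigma_coeff_bounded[OF u, of "K / N" "diameter (A\<^sub>0 \<union> A\<^sub>1)"] small \<kappa> threshold by auto
    have "(SUP (x, y)\<in>A\<^sub>0 \<times> A\<^sub>1. sigma_coeff (K / N) u (dist x y)) \<le> ennreal B"
      using dist_le by (intro SUP_least) (auto intro!: B)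
    then show ?thesis
      by (rule order_le_less_trans) simp
  qed
  have le_SUP: "sigma_coeff (K / N) u (dist x y) \<le> (SUP (x, y)\<in>A\<^sub>0 \<times> A\<^sub>1. sigma_coeff (K / N) u (dist x y))"
    if "x \<in> A\<^sub>0" "y \<in> A\<^sub>1" for u x y
    using that by (intro SUP_upper2[of "(x, y)"]) auto
  show "enn_powr (outer_measure_of m (intermediate_set A\<^sub>0 A\<^sub>1 t)) (1 / N) \<le>
      (if emeasure m A\<^sub>0 = 0 \<or> emeasure m A\<^sub>1 = 0 then \<infinity>
       else (SUP (x, y)\<in>A\<^sub>0 \<times> A\<^sub>1. sigma_coeff (K / N) (1 - t) (dist x y)) * enn_powr (emeasure m A\<^sub>0) (1 / N)
          + (SUP (x, y)\<in>A\<^sub>0 \<times> A\<^sub>1. sigma_coeff (K / N) t (dist x y)) * enn_powr (emeasure m A\<^sub>1) (1 / N))"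
    using CD_with_inequality[OF assms CD[unfolded CD_star_def] A(1) _ A(2) _ t le_SUP finite_SUP le_SUP finite_SUP] t
    by auto
qed

end
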